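(* For every $n\ge1$, the categorical symmetric operad $\mathbf m^n$ (the $n$-fold iterated monoidal category operad) contains both an internal $n$-operad and an internal $n$-cooperad. The same is true for the operad $\tilde{\mathbf m}^n$.
   Context: Trees. For $k\ge0$ let $[k]=\{1<\dots<k\}$. An $n$-tree is a chain $T=([k_n]\xrightarrow{\rho_{n-1}}[k_{n-1}]\to\dots\xrightarrow{\rho_0}[k_0]=[1])$ of order preserving maps; elements of $[k_n]$ are tips, $|T|=k_n$; $U_n$ is the tree with all $[k_i]=[1]$. A morphism $\sigma:T\to S$ in the category $\Omega_n$ is a family of functions $\sigma_m$ between the $m$-th levels commuting with the structure maps such that $\sigma_m$ is order preserving on each fibre $\rho_{m-1}^{-1}(j)$. The fibre $T_i$ of $\sigma$ over a tip $i$ of $S$ is the levelwise pullback of $\sigma$ along the map $U_n\to S$ picking out $i$. Every function $\tau:[p]\to[k]$ factors uniquely as $\nu(\tau)\circ\pi(\tau)$ with $\nu(\tau)$ order preserving and $\pi(\tau)\in\Sigma_p$ order preserving on the fibres of $\tau$; put $\pi(\sigma)=\pi(\sigma_n)$. Internal operads. Let $A$ be a categorical symmetric operad (operad in $(Cat,\times)$ with left $\Sigma_k$-actions on $A_k$), with multiplication $m$ and unit object $e\in A_1$. An internal $n$-operad in $A$ consists of objects $a_T\in A_{|T|}$ for all $n$-trees $T$, morphisms $\mu_\sigma:m(a_S;a_{T_1},\dots,a_{T_k})\to\pi(\sigma)a_T$ for each $\sigma:T\to S$ in $\Omega_n$ with fibres $T_1,\dots,T_k$ over the tips of $S$ in order,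 and a morphism $\epsilon:e\to a_{U_n}$, satisfying associativity (for composites $T\to S\to R$) and unit equations. An internal $n$-cooperad is defined dually, with structure morphisms $\pi(\sigma)a_T\to m(a_S;a_{T_1},\dots,a_{T_k})$ and $a_{U_n}\to e$. (In operads whose categories are posets the equations hold automatically.) The operads. The objects of $\mathbf m^n_k$ are the finite expressions in the symbols $1,\dots,k$, each occurring exactly once, built with $n$ strictly associative binary operations $\diamond_1,\dots,\diamond_n$ having a common strict unit ($\mathbf m^n_0$ is the unit alone, and $e=1\in\mathbf m^n_1$). $\Sigma_k$ acts on the left by replacing each symbol $u$ by its image; operad composition is substitution with the appropriate shift of symbols. Morphisms are generated by the interchange laws $(1\diamond_i2)\diamond_j(3\diamond_i4)\to(1\diamond_j3)\diamond_i(2\diamond_j4)$, $j<i$, under substitution and permutation, modulo the coherence conditions of iterated monoidal categories (Balteanu–Fiedorowicz–Schwänzl–Vogt). Each $\mathbf m^n_k$ is a poset, described as follows: say that $u\diamond_iv$ is in an expression $a$ if replacing all symbols other than $u,v$ by the unit reduces $a$ to $u\diamond_iv$; there is a (unique) morphism $a\to b$ iff whenever $u\diamond_iv$ is in $a$, either $u\diamond_jv$ is in $b$ for some $j\ge i$ or $v\diamond_ju$ is in $b$ for some $j>i$. The operad $\tilde{\mathbf m}^n$ is defined in the same way with operations $\diamond_0,\dots,\diamond_{n-1}$ and reversed interchange morphisms: there is a unique morphism $a\to b$ iff whenever $u\diamond_iv$ is in $a$, either $u\diamond_jv$ is in $b$ for some $j\le i$ or $v\diamond_ju$ is in $b$ for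 some $j<i$. *)

theory Defs
  imports "HOL-Combinatorics.Permutations"
begin

text \<open>Throughout, the ordered set of \<open>k\<close> elements is \<open>{..<k}\<close>, i.e. all numberings (vertices and
  tips of trees, inputs of operations, symbols of expressions) start at \<open>0\<close>. A function from it is
  given by the list of its values. A permutation is a function \<open>\<pi>\<close> with \<open>\<pi> permutes {..<k}\<close>.\<close>

section \<open>Permutations\<close>

text \<open>\<open>sort_perm \<tau>\<close> is the permutation part in the factorisation \<open>\<tau> = \<nu>(\<tau>) \<circ> \<pi>(\<tau>)\<close>.\<close>

definition sort_perm :: "nat list \<Rightarrow> nat \<Rightarrow> nat" where
  "sort_perm \<tau> = (THE \<pi>. \<pi> permutes {..<length \<tau>} \<and>
     (\<exists>\<nu> :: nat \<Rightarrow> nat. mono_on {..<length \<tau>} \<nu> \<and> (\<forall>x<length \<tau>. \<tau> ! x = \<nu> (\<pi> x))) \<and>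
     (\<forall>x y. x < y \<and> y < length \<tau> \<and> \<tau> ! x = \<tau> ! y \<longrightarrow> \<pi> x < \<pi> y))"

text \<open>Consecutive blocks of sizes \<open>js\<close>: \<open>offset js i\<close> is the first element of block \<open>i\<close>, and
  \<open>locate js u\<close> is the pair of the block containing \<open>u\<close> and the position of \<open>u\<close> in it.\<close>

definition offset :: "nat list \<Rightarrow> nat \<Rightarrow> nat" where
  "offset js i = sum_list (take i js)"

fun locate :: "nat list \<Rightarrow> nat \<Rightarrow> nat \<times> nat" where
  "locate [] u = (0, u)"
| "locate (j # js) u = (if u < j then (0, u) else (let (i, r) = locate js (u - j) in (Suc i, r)))"

text \<open>Here \<open>js\<close> lists the block sizes after permuting: \<open>block_perm js \<pi>\<close> moves the \<open>i\<close>-th block,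
  of size \<open>js ! \<pi> i\<close>, to the \<open>\<pi> i\<close>-th place, whereas \<open>sum_perm js \<pi>s\<close> keeps the blocks in place and
  acts on block \<open>i\<close> by \<open>\<pi>s ! i\<close>.\<close>

definition block_perm :: "nat list \<Rightarrow> (nat \<Rightarrow> nat) \<Rightarrow> nat \<Rightarrow> nat" where
  "block_perm js \<pi> u = (if u < sum_list js
     then (let (i, r) = locate (map (\<lambda>i. js ! \<pi> i) [0..<length js]) u in offset js (\<pi> i) + r)
     else u)"

definition sum_perm :: "nat list \<Rightarrow> (nat \<Rightarrow> nat) list \<Rightarrow> nat \<Rightarrow> nat" where
  "sum_perm js \<pi>s u = (if u < sum_list js
     then (let (i, r) = locate js u in offset js i + (\<pi>s ! i) r)
     else u)"

section \<open>Categorical symmetric operads\<close>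

text \<open>Symmetric operads in sets with left actions. \<open>mult js x ys\<close> is \<open>m(x; y\<^sub>1, \<dots>, y\<^sub>k)\<close> where \<open>y\<^sub>i\<close> has
  arity \<open>js ! i\<close>.\<close>

locale symmetric_operad =
  fixes P :: "nat \<Rightarrow> 'x set"
    and act :: "nat \<Rightarrow> (nat \<Rightarrow> nat) \<Rightarrow> 'x \<Rightarrow> 'x"
    and mult :: "nat list \<Rightarrow> 'x \<Rightarrow> 'x list \<Rightarrow> 'x"
    and one :: 'x
  assumes act_closed: "\<lbrakk>\<pi> permutes {..<k}; x \<in> P k\<rbrakk> \<Longrightarrow> act k \<pi> x \<in> P k"
    and act_id: "x \<in> P k \<Longrightarrow> act k id x = x"
    and act_comp: "\<lbrakk>\<pi> permutes {..<k}; \<rho> permutes {..<k}; x \<in> P k\<rbrakk> \<Longrightarrow>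
      act k (\<pi> \<circ> \<rho>) x = act k \<pi> (act k \<rho> x)"
    and mult_closed: "\<lbrakk>x \<in> P (length js); list_all2 (\<lambda>j y. y \<in> P j) js ys\<rbrakk> \<Longrightarrow>
      mult js x ys \<in> P (sum_list js)"
    and one_closed: "one \<in> P 1"
    and mult_one_left: "x \<in> P k \<Longrightarrow> mult [k] one [x] = x"
    and mult_one_right: "x \<in> P k \<Longrightarrow> mult (replicate k 1) x (replicate k one) = x"
    and mult_assoc: "\<lbrakk>x \<in> P (length jss); length ys = length jss; length zss = length jss;
        \<And>i. i < length jss \<Longrightarrow> ys ! i \<in> P (length (jss ! i));
        \<And>i. i < length jss \<Longrightarrow> list_all2 (\<lambda>j z. z \<in> P j) (jss ! i) (zss ! i)\<rbrakk> \<Longrightarrow>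
      mult (concat jss) (mult (map length jss) x ys) (concat zss) =
      mult (map sum_list jss) x (map (\<lambda>i. mult (jss ! i) (ys ! i) (zss ! i)) [0..<length jss])"
    and mult_act_outer: "\<lbrakk>x \<in> P (length js); list_all2 (\<lambda>j y. y \<in> P j) js ys;
        \<pi> permutes {..<length js}\<rbrakk> \<Longrightarrow>
      mult js (act (length js) \<pi> x) ys =
      act (sum_list js) (block_perm js \<pi>)
        (mult (map (\<lambda>i. js ! \<pi> i) [0..<length js]) x (map (\<lambda>i. ys ! \<pi> i) [0..<length js]))"
    and mult_act_inner: "\<lbrakk>x \<in> P (length js); list_all2 (\<lambda>j y. y \<in> P j) js ys;
        length \<pi>s = length js; \<And>i. i < length js \<Longrightarrow> (\<pi>s ! i) permutes {..<js ! i}\<rbrakk> \<Longrightarrow>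
      mult js x (map (\<lambda>i. act (js ! i) (\<pi>s ! i) (ys ! i)) [0..<length js]) =
      act (sum_list js) (sum_perm js \<pi>s) (mult js x ys)"

record ('o, 'm) operad_data =
  Obj :: "nat \<Rightarrow> 'o set"
  Mor :: "nat \<Rightarrow> 'm set"
  Dom :: "nat \<Rightarrow> 'm \<Rightarrow> 'o"
  Cod :: "nat \<Rightarrow> 'm \<Rightarrow> 'o"
  Ident :: "nat \<Rightarrow> 'o \<Rightarrow> 'm"
  Comp :: "nat \<Rightarrow> 'm \<Rightarrow> 'm \<Rightarrow> 'm"  \<comment> \<open>\<open>Comp A k g f\<close> is \<open>f\<close> followed by \<open>g\<close>\<close>
  ActObj :: "nat \<Rightarrow> (nat \<Rightarrow> nat) \<Rightarrow> 'o \<Rightarrow> 'o"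
  ActMor :: "nat \<Rightarrow> (nat \<Rightarrow> nat) \<Rightarrow> 'm \<Rightarrow> 'm"
  MultObj :: "nat list \<Rightarrow> 'o \<Rightarrow> 'o list \<Rightarrow> 'o"
  MultMor :: "nat list \<Rightarrow> 'm \<Rightarrow> 'm list \<Rightarrow> 'm"
  UnitObj :: 'o

definition Hom :: "('o, 'm) operad_data \<Rightarrow> nat \<Rightarrow> 'o \<Rightarrow> 'o \<Rightarrow> 'm set" where
  "Hom A k x y = {f \<in> Mor A k. Dom A k f = x \<and> Cod A k f = y}"

text \<open>An operad in \<open>(Cat, \<times>)\<close>: the objects and the morphisms each form an operad in sets (the unit
  functor being given by the object \<open>UnitObj A\<close> and its identity), every \<open>A\<^sub>k\<close> is a category, and
  the actions and multiplications are functors.\<close>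

locale categorical_symmetric_operad =
  fixes A :: "('o, 'm) operad_data"
  assumes objects_operad: "symmetric_operad (Obj A) (ActObj A) (MultObj A) (UnitObj A)"
    and morphisms_operad: "symmetric_operad (Mor A) (ActMor A) (MultMor A) (Ident A 1 (UnitObj A))"
    and Dom_closed: "f \<in> Mor A k \<Longrightarrow> Dom A k f \<in> Obj A k"
    and Cod_closed: "f \<in> Mor A k \<Longrightarrow> Cod A k f \<in> Obj A k"
    and Ident_Hom: "x \<in> Obj A k \<Longrightarrow> Ident A k x \<in> Hom A k x x"
    and Comp_Hom: "\<lbrakk>f \<in> Hom A k x y; g \<in> Hom A k y z\<rbrakk> \<Longrightarrow> Comp A k g f \<in> Hom A k x z"
    and Comp_Ident_left: "f \<in> Hom A k x y \<Longrightarrow> Comp A k (Ident A k y) f = f"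
    and Comp_Ident_right: "f \<in> Hom A k x y \<Longrightarrow> Comp A k f (Ident A k x) = f"
    and Comp_assoc: "\<lbrakk>f \<in> Hom A k x y; g \<in> Hom A k y z; h \<in> Hom A k z w\<rbrakk> \<Longrightarrow>
      Comp A k h (Comp A k g f) = Comp A k (Comp A k h g) f"
    and Act_Hom: "\<lbrakk>\<pi> permutes {..<k}; f \<in> Hom A k x y\<rbrakk> \<Longrightarrow>
      ActMor A k \<pi> f \<in> Hom A k (ActObj A k \<pi> x) (ActObj A k \<pi> y)"
    and Act_Ident: "\<lbrakk>\<pi> permutes {..<k}; x \<in> Obj A k\<rbrakk> \<Longrightarrow>
      ActMor A k \<pi> (Ident A k x) = Ident A k (ActObj A k \<pi> x)"
    and Act_Comp: "\<lbrakk>\<pi> permutes {..<k}; f \<in> Hom A k x y; g \<in> Hom A k y z\<rbrakk> \<Longrightarrow>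
      ActMor A k \<pi> (Comp A k g f) = Comp A k (ActMor A k \<pi> g) (ActMor A k \<pi> f)"
    and Mult_Hom: "\<lbrakk>f \<in> Hom A (length js) x y; length fs = length js;
        length xs = length js; length ys = length js;
        \<And>i. i < length js \<Longrightarrow> fs ! i \<in> Hom A (js ! i) (xs ! i) (ys ! i)\<rbrakk> \<Longrightarrow>
      MultMor A js f fs \<in> Hom A (sum_list js) (MultObj A js x xs) (MultObj A js y ys)"
    and Mult_Ident: "\<lbrakk>x \<in> Obj A (length js); list_all2 (\<lambda>j y. y \<in> Obj A j) js ys\<rbrakk> \<Longrightarrow>
      MultMor A js (Ident A (length js) x) (map (\<lambda>i. Ident A (js ! i) (ys ! i)) [0..<length js]) =
      Ident A (sum_list js) (MultObj A js x ys)"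
    and Mult_Comp: "\<lbrakk>f \<in> Hom A (length js) x y; g \<in> Hom A (length js) y z;
        length fs = length js; length gs = length js;
        length xs = length js; length ys = length js; length zs = length js;
        \<And>i. i < length js \<Longrightarrow> fs ! i \<in> Hom A (js ! i) (xs ! i) (ys ! i);
        \<And>i. i < length js \<Longrightarrow> gs ! i \<in> Hom A (js ! i) (ys ! i) (zs ! i)\<rbrakk> \<Longrightarrow>
      MultMor A js (Comp A (length js) g f)
        (map (\<lambda>i. Comp A (js ! i) (gs ! i) (fs ! i)) [0..<length js]) =
      Comp A (sum_list js) (MultMor A js g gs) (MultMor A js f fs)"

definition opposite :: "('o, 'm) operad_data \<Rightarrow> ('o, 'm) operad_data" where
  "opposite A = A\<lparr>Dom := Cod A, Cod := Dom A, Comp := (\<lambda>k g f. Comp A k f g)\<rparr>"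

section \<open>Trees\<close>

text \<open>An \<open>n\<close>-tree is the list of its structure maps \<open>\<rho>\<^sub>0, \<dots>, \<rho>\<^bsub>n-1\<^esub>\<close>; \<open>\<rho>\<^sub>m\<close> is a list of length
  \<open>k\<^bsub>m+1\<^esub>\<close>, so that the list determines all \<open>k\<^sub>m\<close> (recall \<open>k\<^sub>0 = 1\<close>).\<close>

type_synonym tree = "nat list list"

definition width :: "tree \<Rightarrow> nat \<Rightarrow> nat" where
  "width T m = (case m of 0 \<Rightarrow> 1 | Suc l \<Rightarrow> length (T ! l))"

definition is_tree :: "nat \<Rightarrow> tree \<Rightarrow> bool" where
  "is_tree n T \<longleftrightarrow> length T = n \<and> (\<forall>m<n. sorted (T ! m) \<and> (\<forall>x\<in>set (T ! m). x < width T m))"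

definition tips :: "tree \<Rightarrow> nat" where
  "tips T = width T (length T)"

definition unit_tree :: "nat \<Rightarrow> tree" where
  "unit_tree n = replicate n [0]"

text \<open>The image of the tip \<open>i\<close> in level \<open>m\<close>, i.e. \<open>\<rho>\<^sub>m (\<dots> (\<rho>\<^bsub>n-1\<^esub> i))\<close>; as \<open>m\<close> varies these vertices
  form the map from \<open>unit_tree n\<close> that picks out \<open>i\<close>.\<close>

definition ancestor :: "tree \<Rightarrow> nat \<Rightarrow> nat \<Rightarrow> nat" where
  "ancestor T m i = fold (\<lambda>l x. T ! l ! x) (rev [m..<length T]) i"

text \<open>A morphism of \<open>n\<close>-trees is the list of its components \<open>\<sigma>\<^sub>0, \<dots>, \<sigma>\<^sub>n\<close>.\<close>

type_synonym tree_map = "nat list list"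

definition tree_hom :: "nat \<Rightarrow> tree \<Rightarrow> tree \<Rightarrow> tree_map set" where
  "tree_hom n T S = {\<sigma>. is_tree n T \<and> is_tree n S \<and> length \<sigma> = Suc n \<and>
     (\<forall>m\<le>n. length (\<sigma> ! m) = width T m \<and> (\<forall>x<width T m. \<sigma> ! m ! x < width S m)) \<and>
     (\<forall>m<n. \<forall>x<width T (Suc m). S ! m ! (\<sigma> ! Suc m ! x) = \<sigma> ! m ! (T ! m ! x)) \<and>
     (\<forall>m<n. \<forall>x y. x \<le> y \<and> y < width T (Suc m) \<and> T ! m ! x = T ! m ! y \<longrightarrow>
        \<sigma> ! Suc m ! x \<le> \<sigma> ! Suc m ! y)}"

definition tree_id :: "tree \<Rightarrow> tree_map" where
  "tree_id T = map (\<lambda>m. [0..<width T m]) [0..<Suc (length T)]"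

definition tree_to_unit :: "tree \<Rightarrow> tree_map" where
  "tree_to_unit T = map (\<lambda>m. replicate (width T m) 0) [0..<Suc (length T)]"

definition tree_comp :: "tree_map \<Rightarrow> tree_map \<Rightarrow> tree_map" where
  "tree_comp \<omega> \<sigma> = map (\<lambda>m. map (\<lambda>x. \<omega> ! m ! x) (\<sigma> ! m)) [0..<length \<sigma>]"

text \<open>The vertices of \<open>T\<close> in level \<open>m\<close> that lie over the tip \<open>i\<close> of \<open>S\<close>, in increasing order. The
  fibre is the tree obtained by renumbering them.\<close>

definition fibre_vertices :: "tree \<Rightarrow> tree \<Rightarrow> tree_map \<Rightarrow> nat \<Rightarrow> nat \<Rightarrow> nat list" where
  "fibre_vertices T S \<sigma> i m = filter (\<lambda>x. \<sigma> ! m ! x = ancestor S m i) [0..<width T m]"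

definition rank :: "nat list \<Rightarrow> nat \<Rightarrow> nat" where
  "rank xs x = length (filter (\<lambda>y. y < x) xs)"

definition fibre :: "tree \<Rightarrow> tree \<Rightarrow> tree_map \<Rightarrow> nat \<Rightarrow> tree" where
  "fibre T S \<sigma> i = map (\<lambda>m. map (\<lambda>x. rank (fibre_vertices T S \<sigma> i m) (T ! m ! x))
     (fibre_vertices T S \<sigma> i (Suc m))) [0..<length T]"

definition fibres :: "tree \<Rightarrow> tree \<Rightarrow> tree_map \<Rightarrow> tree list" where
  "fibres T S \<sigma> = map (fibre T S \<sigma>) [0..<tips S]"

text \<open>For \<open>T \<rightarrow> S \<rightarrow> R\<close> given by \<open>\<sigma>\<close> and \<open>\<omega>\<close>, the morphism induced by \<open>\<sigma>\<close> from the fibre of the composite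
  over the tip \<open>i\<close> of \<open>R\<close> to the fibre of \<open>\<omega>\<close> over \<open>i\<close>.\<close>

definition fibre_map :: "tree \<Rightarrow> tree \<Rightarrow> tree \<Rightarrow> tree_map \<Rightarrow> tree_map \<Rightarrow> nat \<Rightarrow> tree_map" where
  "fibre_map T S R \<sigma> \<omega> i = map (\<lambda>m. map (\<lambda>x. rank (fibre_vertices S R \<omega> i m) (\<sigma> ! m ! x))
     (fibre_vertices T R (tree_comp \<omega> \<sigma>) i m)) [0..<Suc (length T)]"

definition tip_perm :: "tree_map \<Rightarrow> nat \<Rightarrow> nat" where
  "tip_perm \<sigma> = sort_perm (last \<sigma>)"

section \<open>Internal operads and cooperads\<close>

text \<open>Associativity, for \<open>T \<rightarrow> S \<rightarrow> R\<close> given by \<open>\<sigma>\<close> and \<open>\<omega>\<close> with \<open>\<pi> = \<pi>(\<omega>)\<close>, equates two morphisms out of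
  \<open>m(m(a\<^sub>R; a\<^bsub>S\<^sub>1\<^esub>, \<dots>, a\<^bsub>S\<^sub>r\<^esub>); \<dots>) = m(a\<^sub>R; \<dots>, m(a\<^bsub>S\<^sub>i\<^esub>; \<dots>), \<dots>)\<close>, where the dots in inner position are the objects
  of the fibres of \<open>\<sigma>\<close>. The inputs of \<open>m(a\<^sub>R; a\<^bsub>S\<^sub>1\<^esub>, \<dots>, a\<^bsub>S\<^sub>r\<^esub>)\<close> are the tips of \<open>S\<close> sorted by \<open>\<omega>\<close>, so its
  \<open>q\<close>-th input receives the fibre of \<open>\<sigma>\<close> over the tip \<open>\<pi>\<inverse> q\<close>; this is the list \<open>Ts\<close>. By equivariance
  \<open>m(\<pi> a\<^sub>S; a\<^bsub>Ts\<^esub>)\<close> is the block permutation of \<open>m(a\<^sub>S; a\<^bsub>T\<^sub>1\<^esub>, \<dots>, a\<^bsub>T\<^sub>s\<^esub>)\<close>.\<close>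

locale internal_operad = categorical_symmetric_operad A
  for A :: "('o, 'm) operad_data" +
  fixes n :: nat
    and a :: "tree \<Rightarrow> 'o"
    and \<mu> :: "tree \<Rightarrow> tree \<Rightarrow> tree_map \<Rightarrow> 'm"  \<comment> \<open>source, target, morphism\<close>
    and \<epsilon> :: 'm
  assumes a_closed: "is_tree n T \<Longrightarrow> a T \<in> Obj A (tips T)"
    and \<mu>_Hom: "\<sigma> \<in> tree_hom n T S \<Longrightarrow>
      \<mu> T S \<sigma> \<in> Hom A (tips T)
        (MultObj A (map tips (fibres T S \<sigma>)) (a S) (map a (fibres T S \<sigma>)))
        (ActObj A (tips T) (tip_perm \<sigma>) (a T))"
    and \<epsilon>_Hom: "\<epsilon> \<in> Hom A 1 (UnitObj A) (a (unit_tree n))"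
    and associativity: "\<lbrakk>\<sigma> \<in> tree_hom n T S; \<omega> \<in> tree_hom n S R\<rbrakk> \<Longrightarrow>
      (let \<pi> = tip_perm \<omega>;
           Ts = map (\<lambda>q. fibre T S \<sigma> (inv \<pi> q)) [0..<tips S];
           Ts' = fibres T R (tree_comp \<omega> \<sigma>);
           \<sigma>s = map (fibre_map T S R \<sigma> \<omega>) [0..<tips R]
       in Comp A (tips T)
            (ActMor A (tips T) (block_perm (map tips Ts) \<pi>) (\<mu> T S \<sigma>))
            (MultMor A (map tips Ts) (\<mu> S R \<omega>) (map (\<lambda>U. Ident A (tips U) (a U)) Ts))
        = Comp A (tips T)
            (ActMor A (tips T) (sum_perm (map tips Ts') (map tip_perm \<sigma>s)) (\<mu> T R (tree_comp \<omega> \<sigma>)))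
            (MultMor A (map tips Ts') (Ident A (tips R) (a R))
              (map (\<lambda>i. \<mu> (Ts' ! i) (fibre S R \<omega> i) (\<sigma>s ! i)) [0..<tips R])))"
    and unit_outer: "is_tree n T \<Longrightarrow>
      Comp A (tips T) (\<mu> T (unit_tree n) (tree_to_unit T))
        (MultMor A [tips T] \<epsilon> [Ident A (tips T) (a T)]) = Ident A (tips T) (a T)"
    and unit_inner: "is_tree n T \<Longrightarrow>
      Comp A (tips T) (\<mu> T T (tree_id T))
        (MultMor A (replicate (tips T) 1) (Ident A (tips T) (a T)) (replicate (tips T) \<epsilon>)) =
      Ident A (tips T) (a T)"

definition contains_internal_operad :: "('o, 'm) operad_data \<Rightarrow> nat \<Rightarrow> bool" where
  "contains_internal_operad A n \<longleftrightarrow> (\<exists>a \<mu> \<epsilon>. internal_operad A n a \<mu> \<epsilon>)"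

text \<open>An internal cooperad consists of objects, morphisms \<open>\<pi>(\<sigma>) a\<^sub>T \<rightarrow> m(a\<^sub>S; a\<^bsub>T\<^sub>1\<^esub>, \<dots>, a\<^bsub>T\<^sub>k\<^esub>)\<close> and a morphism
  \<open>a\<^bsub>U\<^sub>n\<^esub> \<rightarrow> e\<close> subject to the dual equations.\<close>

definition internal_cooperad ::
  "('o, 'm) operad_data \<Rightarrow> nat \<Rightarrow> (tree \<Rightarrow> 'o) \<Rightarrow> (tree \<Rightarrow> tree \<Rightarrow> tree_map \<Rightarrow> 'm) \<Rightarrow> 'm \<Rightarrow> bool" where
  "internal_cooperad A n a \<nu> \<eta> \<longleftrightarrow>
     categorical_symmetric_operad A \<and> internal_operad (opposite A) n a \<nu> \<eta>"

definition contains_internal_cooperad :: "('o, 'm) operad_data \<Rightarrow> nat \<Rightarrow> bool" where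
  "contains_internal_cooperad A n \<longleftrightarrow> (\<exists>a \<nu> \<eta>. internal_cooperad A n a \<nu> \<eta>)"

section \<open>Expressions\<close>

datatype raw_expr = RNeutral | RSym nat | ROp nat raw_expr raw_expr

inductive expr_eq :: "raw_expr \<Rightarrow> raw_expr \<Rightarrow> bool" where
  refl: "expr_eq a a"
| sym: "expr_eq a b \<Longrightarrow> expr_eq b a"
| trans: "expr_eq a b \<Longrightarrow> expr_eq b c \<Longrightarrow> expr_eq a c"
| cong: "expr_eq a a' \<Longrightarrow> expr_eq b b' \<Longrightarrow> expr_eq (ROp i a b) (ROp i a' b')"
| assoc: "expr_eq (ROp i (ROp i a b) c) (ROp i a (ROp i b c))"
| neutral_left: "expr_eq (ROp i RNeutral a) a"
| neutral_right: "expr_eq (ROp i a RNeutral) a"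

quotient_type expr = raw_expr / expr_eq
  by (rule equivpI) (auto intro!: reflpI sympI transpI intro: expr_eq.intros)

lift_definition Neutral :: expr is RNeutral .

lift_definition Sym :: "nat \<Rightarrow> expr" is RSym .

lift_definition Op :: "nat \<Rightarrow> expr \<Rightarrow> expr \<Rightarrow> expr" is ROp
  by (rule expr_eq.cong)

primrec raw_subst :: "(nat \<Rightarrow> raw_expr) \<Rightarrow> raw_expr \<Rightarrow> raw_expr" where
  "raw_subst f RNeutral = RNeutral"
| "raw_subst f (RSym u) = f u"
| "raw_subst f (ROp i a b) = ROp i (raw_subst f a) (raw_subst f b)"

lift_definition subst :: "(nat \<Rightarrow> expr) \<Rightarrow> expr \<Rightarrow> expr" is raw_subst
proof -
  fix f g :: "nat \<Rightarrow> raw_expr" and a b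
  assume fg: "\<And>u. expr_eq (f u) (g u)" and ab: "expr_eq a b"
  have "expr_eq (raw_subst f c) (raw_subst g c)" for c
    by (induction c) (auto intro: fg expr_eq.intros)
  moreover from ab have "expr_eq (raw_subst g a) (raw_subst g b)"
    by (induction rule: expr_eq.induct) (auto intro: expr_eq.intros)
  ultimately show "expr_eq (raw_subst f a) (raw_subst g b)"
    by (rule expr_eq.trans)
qed

primrec raw_syms :: "raw_expr \<Rightarrow> nat list" where
  "raw_syms RNeutral = []"
| "raw_syms (RSym u) = [u]"
| "raw_syms (ROp i a b) = raw_syms a @ raw_syms b"

primrec raw_ops :: "raw_expr \<Rightarrow> nat set" where
  "raw_ops RNeutral = {}"
| "raw_ops (RSym u) = {}"
| "raw_ops (ROp i a b) = insert i (raw_ops a \<union> raw_ops b)"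

text \<open>Since operations with a neutral argument can be cancelled, the operations occurring in an
  expression depend on the representative.\<close>

definition linear_exprs :: "nat set \<Rightarrow> nat \<Rightarrow> expr set" where
  "linear_exprs I k = {abs_expr r | r. raw_ops r \<subseteq> I \<and>
     distinct (raw_syms r) \<and> set (raw_syms r) = {..<k}}"

text \<open>\<open>u \<diamond>\<^sub>i v\<close> is in \<open>a\<close>:\<close>

definition is_in :: "nat \<Rightarrow> nat \<Rightarrow> nat \<Rightarrow> expr \<Rightarrow> bool" where
  "is_in u i v a \<longleftrightarrow>
     subst (\<lambda>w. if w = u \<or> w = v then Sym w else Neutral) a = Op i (Sym u) (Sym v)"

definition expr_mult :: "nat list \<Rightarrow> expr \<Rightarrow> expr list \<Rightarrow> expr" where
  "expr_mult js x ys = subst (\<lambda>q. subst (\<lambda>w. Sym (offset js q + w)) (ys ! q)) x"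

definition expr_act :: "nat \<Rightarrow> (nat \<Rightarrow> nat) \<Rightarrow> expr \<Rightarrow> expr" where
  "expr_act k \<pi> x = subst (\<lambda>u. Sym (\<pi> u)) x"

section \<open>The operads of iterated monoidal categories\<close>

text \<open>The operad of expressions with operations indexed by \<open>I\<close>, with at most one morphism from \<open>a\<close> to
  \<open>b\<close>, namely \<open>(a, b)\<close> in case \<open>le a b\<close>.\<close>

definition expr_operad ::
  "nat set \<Rightarrow> (expr \<Rightarrow> expr \<Rightarrow> bool) \<Rightarrow> (expr, expr \<times> expr) operad_data" where
  "expr_operad I le = \<lparr>
     Obj = linear_exprs I,
     Mor = (\<lambda>k. {(a, b). a \<in> linear_exprs I k \<and> b \<in> linear_exprs I k \<and> le a b}),
     Dom = (\<lambda>k. fst),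
     Cod = (\<lambda>k. snd),
     Ident = (\<lambda>k a. (a, a)),
     Comp = (\<lambda>k g f. (fst f, snd g)),
     ActObj = expr_act,
     ActMor = (\<lambda>k \<pi> f. (expr_act k \<pi> (fst f), expr_act k \<pi> (snd f))),
     MultObj = expr_mult,
     MultMor = (\<lambda>js f fs. (expr_mult js (fst f) (map fst fs), expr_mult js (snd f) (map snd fs))),
     UnitObj = Sym 0\<rparr>"

text \<open>The morphisms are generated by the interchange laws
  \<open>(1 \<diamond>\<^sub>i 2) \<diamond>\<^sub>j (3 \<diamond>\<^sub>i 4) \<rightarrow> (1 \<diamond>\<^sub>j 3) \<diamond>\<^sub>i (2 \<diamond>\<^sub>j 4)\<close> for \<open>j < i\<close>; by coherence (Balteanu, Fiedorowicz, Schwaenzl,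
  Vogt) each category of operations is the poset given by the following relation. For
  \<open>le_m_tilde\<close> the interchange morphisms are reversed.\<close>

definition le_m :: "expr \<Rightarrow> expr \<Rightarrow> bool" where
  "le_m a b \<longleftrightarrow> (\<forall>u i v. is_in u i v a \<longrightarrow>
     (\<exists>j\<ge>i. is_in u j v b) \<or> (\<exists>j>i. is_in v j u b))"

definition m_operad :: "nat \<Rightarrow> (expr, expr \<times> expr) operad_data" where
  "m_operad n = expr_operad {1..n} le_m"

definition le_m_tilde :: "expr \<Rightarrow> expr \<Rightarrow> bool" where
  "le_m_tilde a b \<longleftrightarrow> (\<forall>u i v. is_in u i v a \<longrightarrow>
     (\<exists>j\<le>i. is_in u j v b) \<or> (\<exists>j<i. is_in v j u b))"

definition m_tilde_operad :: "nat \<Rightarrow> (expr, expr \<times> expr) operad_data" where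
  "m_tilde_operad n = expr_operad {0..<n} le_m_tilde"

end

theory Submission
  imports Defs
begin

text \<open>For a strictly monotone function \<open>f\<close> on the levels, let \<open>a\<^sub>T\<close> be the expression that combines the
  tips of \<open>T\<close> by \<open>\<diamond>\<^bsub>f(m)\<^esub>\<close> at the vertices of level \<open>m\<close>. Thus \<open>u \<diamond>\<^bsub>f(m)\<^esub> v\<close> is in \<open>a\<^sub>T\<close> iff the ancestors of
  \<open>u < v\<close> last agree in level \<open>m\<close>. A morphism \<open>\<sigma> : T \<rightarrow> S\<close> can only raise the level in which two tips
  meet, and preserves their order unless it raises the level strictly. Hence \<open>m(a\<^sub>S; \<dots>)\<close> and
  \<open>\<pi>(\<sigma>) a\<^sub>T\<close>, which agree on pairs in the same fibre, are comparable: an increasing \<open>f\<close> gives a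
  cooperad and a decreasing one an operad in \<open>\<^bold>m\<^sup>n\<close>, and vice versa for the tilde version. As there
  is at most one morphism between two objects, the equations only require sources and targets to
  coincide. For this, all expressions are relabelled by the tips of \<open>T\<close>: then \<open>m(a\<^sub>S; \<dots>)\<close> becomes
  \<open>a\<^sub>S\<close> with each tip \<open>j\<close> replaced by the restriction of \<open>a\<^sub>T\<close> to the fibre over \<open>j\<close>.\<close>

section \<open>Expressions\<close>

text \<open>The meeting level can only rise because ancestors commute with \<sigma>: tips of T that
  agree in level m have images that agree in level m of S. If the level stays the same, the images
  come from distinct siblings in T, and \<sigma> is monotone on siblings. If it rises strictly, the
  order may flip, and a flip is what the poset permits precisely when the index changes strictly in
  the right direction; this is why \<open>f\<close> has to be strictly monotone. With
  \<open>lt\<close> standing for < or >, one argument serves both operads.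

  Two obstacles shape the rest. Expressions are equivalence classes, so the relation that \<diamond>
  joins u to v cannot be computed by recursion from \<open>is_in\<close>, which compares a
  restriction with a given class; \<open>links\<close> is the computable substitute. Moreover the
  two ends of each morphism number their inputs by positions in blocks, with shifts and
  permutations. Reading positions off a list of tips turns composition into plain substitution, and
  since the lists have no repetitions this renaming can be undone.\<close>

lemma expr_induct [case_names Neutral Sym Op, induct type: expr]:
  assumes "P Neutral" "\<And>u. P (Sym u)" "\<And>i a b. P a \<Longrightarrow> P b \<Longrightarrow> P (Op i a b)"
  shows "P a"
proof -
  have "P (abs_expr r)" for r
    by (induction r) (use assms in \<open>auto simp flip: Neutral.abs_eq Sym.abs_eq Op.abs_eq\<close>)
  then show ?thesis
    by (metis Quotient_abs_rep Quotient_expr)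
qed

lemma Op_Neutral_left [simp]: "Op i Neutral a = a"
  by transfer (rule expr_eq.neutral_left)

lemma Op_Neutral_right [simp]: "Op i a Neutral = a"
  by transfer (rule expr_eq.neutral_right)

lemma subst_simps [simp]:
  "subst f Neutral = Neutral"
  "subst f (Sym u) = f u"
  "subst f (Op i a b) = Op i (subst f a) (subst f b)"
  by (transfer, simp add: expr_eq.refl)+

text \<open>Associativity and the unit laws never exchange two operands, so the list together with
  its order is an invariant of the class.\<close>

lift_definition syms :: "expr \<Rightarrow> nat list" is raw_syms
  by (erule expr_eq.induct) auto

lemma syms_simps [simp]:
  "syms Neutral = []" "syms (Sym u) = [u]" "syms (Op i a b) = syms a @ syms b"
  by (transfer, simp)+

primrec raw_links :: "raw_expr \<Rightarrow> (nat \<times> nat \<times> nat) set" where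
  "raw_links RNeutral = {}"
| "raw_links (RSym u) = {}"
| "raw_links (ROp i a b) =
    raw_links a \<union> raw_links b \<union> set (raw_syms a) \<times> {i} \<times> set (raw_syms b)"

lemma raw_syms_expr_eq: "expr_eq a b \<Longrightarrow> raw_syms a = raw_syms b"
  by (erule expr_eq.induct) auto

text \<open>On linear expressions, \<open>(u, i, v) \<in> links a\<close> says that \<open>u \<diamond>\<^sub>i v\<close> is in \<open>a\<close>, but unlike \<open>is_in\<close> it is
  defined by recursion.\<close>

lift_definition links :: "expr \<Rightarrow> (nat \<times> nat \<times> nat) set" is raw_links
  by (erule expr_eq.induct) (auto dest: raw_syms_expr_eq)

lemma links_simps [simp]:
  "links Neutral = {}"
  "links (Sym u) = {}"
  "links (Op i a b) = links a \<union> links b \<union> set (syms a) \<times> {i} \<times> set (syms b)"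
  by (transfer, simp)+

lemma links_syms: "(u, i, v) \<in> links a \<Longrightarrow> u \<in> set (syms a) \<and> v \<in> set (syms a)"
  by (induction a) auto

lemma subst_subst: "subst f (subst g a) = subst (\<lambda>u. subst f (g u)) a"
  by (induction a) auto

lemma subst_Sym [simp]: "subst Sym a = a"
  by (induction a) auto

lemma subst_cong: "(\<And>u. u \<in> set (syms a) \<Longrightarrow> f u = g u) \<Longrightarrow> subst f a = subst g a"
  by (induction a) auto

lemma subst_Neutral: "(\<And>u. u \<in> set (syms a) \<Longrightarrow> f u = Neutral) \<Longrightarrow> subst f a = Neutral"
  by (induction a) auto

lemma syms_subst: "syms (subst f a) = concat (map (\<lambda>u. syms (f u)) (syms a))"
  by (induction a) auto

text \<open>Substitution is operad composition without the shifts. A link of the result either lies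
  inside one substituted expression or comes from a link q, q' of the outer expression, which then
  decides the operation. All later computations of \<open>links\<close> for composites rest on this
  dichotomy.\<close>

lemma links_subst:
  "links (subst f a) = (\<Union>q\<in>set (syms a). links (f q)) \<union>
     (\<Union>(q, i, q')\<in>links a. set (syms (f q)) \<times> {i} \<times> set (syms (f q')))"
  by (induction a) (auto simp: syms_subst)

section \<open>Relabelling and restricting the symbols of an expression\<close>

abbreviation relabel :: "(nat \<Rightarrow> nat) \<Rightarrow> expr \<Rightarrow> expr" where
  "relabel g \<equiv> subst (\<lambda>u. Sym (g u))"

abbreviation restr :: "(nat \<Rightarrow> bool) \<Rightarrow> expr \<Rightarrow> expr" where
  "restr P \<equiv> subst (\<lambda>u. if P u then Sym u else Neutral)"

lemma syms_relabel: "syms (relabel g a) = map g (syms a)"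
  by (simp add: syms_subst)

lemma relabel_id: "(\<And>u. u \<in> set (syms a) \<Longrightarrow> g u = u) \<Longrightarrow> relabel g a = a"
  using subst_cong[of a "\<lambda>u. Sym (g u)" Sym] by simp

text \<open>In a list without repetitions an entry determines its position, so the renaming has a
  left inverse on the symbols that occur. Equality of two composites can therefore be tested after
  naming their inputs by tips.\<close>

lemma relabel_nth_inject:
  assumes "relabel ((!) M) a = relabel ((!) M) b" and "distinct M"
    and "set (syms a) \<subseteq> {..<length M}" "set (syms b) \<subseteq> {..<length M}"
  shows "a = b"
proof -
  define h where "h = the_inv_into {..<length M} ((!) M)"
  have "h (M ! p) = p" if "p < length M" for p
    unfolding h_def using that \<open>distinct M\<close>
    by (intro the_inv_into_f_f) (auto simp: inj_on_def nth_eq_iff_index_eq)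
  then have "relabel h (relabel ((!) M) a) = a" "relabel h (relabel ((!) M) b) = b"
    using assms(3,4) by (auto simp: subst_subst intro!: relabel_id)
  with assms(1) show ?thesis by metis
qed

text \<open>\<open>raw_ops\<close> is not invariant under the unit laws, so
  \<open>linear_exprs\<close> asks for some good representative. Closure under the operations is the
  corresponding notion on classes, and it permits induction.\<close>

inductive_set exprs :: "nat set \<Rightarrow> expr set" for I where
  Neutral: "Neutral \<in> exprs I"
| Sym: "Sym u \<in> exprs I"
| Op: "\<lbrakk>i \<in> I; a \<in> exprs I; b \<in> exprs I\<rbrakk> \<Longrightarrow> Op i a b \<in> exprs I"

lemma subst_exprs:
  "a \<in> exprs I \<Longrightarrow> (\<And>u. u \<in> set (syms a) \<Longrightarrow> f u \<in> exprs I) \<Longrightarrow> subst f a \<in> exprs I"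
  by (induction rule: exprs.induct) (auto intro: exprs.intros)

lemma linear_exprs_iff:
  "a \<in> linear_exprs I k \<longleftrightarrow> a \<in> exprs I \<and> distinct (syms a) \<and> set (syms a) = {..<k}"
proof -
  have "raw_ops r \<subseteq> I \<Longrightarrow> abs_expr r \<in> exprs I" for r
    by (induction r) (auto simp flip: Neutral.abs_eq Sym.abs_eq Op.abs_eq intro: exprs.intros)
  moreover have "\<exists>r. a = abs_expr r \<and> raw_ops r \<subseteq> I" if "a \<in> exprs I"
    using that
  proof (induction rule: exprs.induct)
    case (Op i a b)
    then obtain r s where "a = abs_expr r" "raw_ops r \<subseteq> I" "b = abs_expr s" "raw_ops s \<subseteq> I"
      by blast
    with Op show ?case
      by (intro exI[of _ "ROp i r s"]) (auto simp: Op.abs_eq)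
  qed (auto simp: Neutral.abs_eq Sym.abs_eq intro: exI[of _ RNeutral] exI[of _ "RSym _"])
  ultimately show ?thesis
    unfolding linear_exprs_def by (auto simp: syms.abs_eq) (metis)
qed

text \<open>Linearity places every symbol in a single operand. Restricting to u and v thus erases an
  operand that contains neither, and leaves one symbol on each side when the outermost operation
  separates them.\<close>

lemma is_in_iff_links:
  assumes "distinct (syms a)"
  shows "is_in u i v a \<longleftrightarrow> (u, i, v) \<in> links a"
proof
  let ?f = "\<lambda>w. if w = u \<or> w = v then Sym w else Neutral"
  assume "is_in u i v a"
  then have eq: "subst ?f a = Op i (Sym u) (Sym v)"
    by (simp add: is_in_def)
  then have "(u, i, v) \<in> links (subst ?f a)"
    by simp
  then show "(u, i, v) \<in> links a"
    by (auto simp: links_subst split: if_splits)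
next
  \<comment> \<open>This serves the case of separation: in an operand that contains only one of the
    two symbols, the restriction leaves that symbol alone.\<close>
  have restr_Sym: "restr (\<lambda>w. w = x \<or> w = y) b = Sym x"
    if "x \<in> set (syms b)" "y \<notin> set (syms b)" "distinct (syms b)" for x y b
    using that
  proof (induction b)
    case (Op j b c)
    have "restr (\<lambda>w. w = x \<or> w = y) d = Neutral"
      if "x \<notin> set (syms d)" "y \<notin> set (syms d)" for d
      using that by (intro subst_Neutral) auto
    moreover have "x \<notin> set (syms b) \<or> x \<notin> set (syms c)"
      using Op.prems by auto
    ultimately show ?case
      using Op by auto
  qed auto
  assume "(u, i, v) \<in> links a"
  with assms show "is_in u i v a"
    unfolding is_in_def
  proof (induction a)
    case (Op j a b)
    have Neutral: "restr (\<lambda>w. w = u \<or> w = v) d = Neutral"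
      if "u \<notin> set (syms d)" "v \<notin> set (syms d)" for d
      using that by (intro subst_Neutral) auto
    consider "(u, i, v) \<in> links a" | "(u, i, v) \<in> links b"
      | "i = j" "u \<in> set (syms a)" "v \<in> set (syms b)"
      using Op.prems by auto
    then show ?case
    proof cases
      case 1
      with Op.prems links_syms[OF 1] have "u \<notin> set (syms b)" "v \<notin> set (syms b)" by auto
      with 1 Op show ?thesis by (simp add: Neutral)
    next
      case 2
      with Op.prems links_syms[OF 2] have "u \<notin> set (syms a)" "v \<notin> set (syms a)" by auto
      with 2 Op show ?thesis by (simp add: Neutral)
    next
      case 3
      with Op.prems have "u \<notin> set (syms b)" "v \<notin> set (syms a)" by auto
      with 3 Op.prems restr_Sym[of u a v] restr_Sym[of v b u] show ?thesis
        by (simp add: disj_commute)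
    qed
  qed auto
qed

text \<open>A common form of \<open>le_m\<close> and \<open>le_m_tilde\<close>, for \<open>lt\<close> the relations \<open><\<close> and \<open>>\<close>.\<close>

definition le_by :: "(nat \<Rightarrow> nat \<Rightarrow> bool) \<Rightarrow> expr \<Rightarrow> expr \<Rightarrow> bool" where
  "le_by lt a b \<longleftrightarrow> (\<forall>u i v. is_in u i v a \<longrightarrow>
     (\<exists>j. (lt i j \<or> i = j) \<and> is_in u j v b) \<or> (\<exists>j. lt i j \<and> is_in v j u b))"

lemma le_m_eq: "le_m = le_by (<)"
  by (simp add: fun_eq_iff le_m_def le_by_def le_less)

lemma le_m_tilde_eq: "le_m_tilde = le_by (>)"
proof -
  have "j \<le> i \<longleftrightarrow> j < i \<or> i = j" for i j :: nat
    by auto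
  then show ?thesis
    by (simp add: fun_eq_iff le_m_tilde_def le_by_def)
qed

text \<open>The order in a form that \<open>links_subst\<close> can evaluate on composites; on
  linear expressions it agrees with \<open>le_by\<close>.\<close>

definition le_links :: "(nat \<Rightarrow> nat \<Rightarrow> bool) \<Rightarrow> expr \<Rightarrow> expr \<Rightarrow> bool" where
  "le_links lt a b \<longleftrightarrow> (\<forall>u i v. (u, i, v) \<in> links a \<longrightarrow>
     (\<exists>j. (lt i j \<or> i = j) \<and> (u, j, v) \<in> links b) \<or> (\<exists>j. lt i j \<and> (v, j, u) \<in> links b))"

lemma le_by_iff_le_links:
  "\<lbrakk>a \<in> linear_exprs I k; b \<in> linear_exprs I k\<rbrakk> \<Longrightarrow> le_by lt a b \<longleftrightarrow> le_links lt a b"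
  by (simp add: le_by_def le_links_def linear_exprs_iff is_in_iff_links)

lemma le_by_refl: "le_by lt a a"
  by (auto simp: le_by_def)

text \<open>A pair may be flipped only along a strict step. So one flip makes the total step strict,
  and two flips restore the orientation.\<close>

lemma le_by_trans:
  assumes "transp lt" and ab: "le_by lt a b" and bc: "le_by lt b c"
  shows "le_by lt a c"
  unfolding le_by_def
proof (intro allI impI)
  have trans: "lt x y \<Longrightarrow> lt y z \<Longrightarrow> lt x z" for x y z
    using \<open>transp lt\<close> by (rule transpD)
  fix u i v
  assume "is_in u i v a"
  with ab consider j where "lt i j \<or> i = j" "is_in u j v b" | j where "lt i j" "is_in v j u b"
    unfolding le_by_def by blast
  then show "(\<exists>j. (lt i j \<or> i = j) \<and> is_in u j v c) \<or> (\<exists>j. lt i j \<and> is_in v j u c)"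
  proof cases
    case 1
    with bc consider l where "lt j l \<or> j = l" "is_in u l v c" | l where "lt j l" "is_in v l u c"
      unfolding le_by_def by blast
    then show ?thesis using 1 by cases (blast intro: trans)+
  next
    case 2
    with bc consider l where "lt j l \<or> j = l" "is_in v l u c" | l where "lt j l" "is_in u l v c"
      unfolding le_by_def by blast
    then show ?thesis using 2 by cases (blast intro: trans)+
  qed
qed

text \<open>A pair inside one substituted expression is compared by \<open>f q\<close> and
  \<open>g q\<close>, a pair spread over two of them by \<open>x\<close> and \<open>y\<close>.
  Equality of the symbol sets carries membership from \<open>f\<close> to \<open>g\<close>.\<close>

lemma le_links_subst:
  assumes "le_links lt x y" "set (syms x) = set (syms y)"
    and "\<And>q. q \<in> set (syms x) \<Longrightarrow> le_links lt (f q) (g q)"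
    and "\<And>q. q \<in> set (syms x) \<Longrightarrow> set (syms (f q)) = set (syms (g q))"
  shows "le_links lt (subst f x) (subst g y)"
  unfolding le_links_def
proof (intro allI impI)
  fix u i v
  assume "(u, i, v) \<in> links (subst f x)"
  then consider q where "q \<in> set (syms x)" "(u, i, v) \<in> links (f q)"
    | q q' where "(q, i, q') \<in> links x" "u \<in> set (syms (f q))" "v \<in> set (syms (f q'))"
    by (auto simp: links_subst)
  then show "(\<exists>j. (lt i j \<or> i = j) \<and> (u, j, v) \<in> links (subst g y)) \<or>
    (\<exists>j. lt i j \<and> (v, j, u) \<in> links (subst g y))"
  proof cases
    case 1
    then have "(\<exists>j. (lt i j \<or> i = j) \<and> (u, j, v) \<in> links (g q)) \<or>
        (\<exists>j. lt i j \<and> (v, j, u) \<in> links (g q))"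
      using assms(3) unfolding le_links_def by blast
    moreover have "links (g q) \<subseteq> links (subst g y)"
      using 1 assms(2) by (auto simp: links_subst)
    ultimately show ?thesis by blast
  next
    case 2
    then have "(\<exists>j. (lt i j \<or> i = j) \<and> (q, j, q') \<in> links y) \<or>
        (\<exists>j. lt i j \<and> (q', j, q) \<in> links y)"
      using assms(1) unfolding le_links_def by blast
    moreover have "u \<in> set (syms (g q))" "v \<in> set (syms (g q'))"
      using 2 links_syms[OF 2(1)] assms(4) by auto
    ultimately show ?thesis
      unfolding links_subst by blast
  qed
qed

lemma le_links_relabel:
  "le_links lt x y \<Longrightarrow> set (syms x) = set (syms y) \<Longrightarrow> le_links lt (relabel g x) (relabel g y)"
  by (rule le_links_subst) (auto simp: le_links_def)

section \<open>The operad of expressions\<close>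

lemma offset_0 [simp]: "offset js 0 = 0"
  by (simp add: offset_def)

lemma offset_Cons_Suc [simp]: "offset (j # js) (Suc i) = j + offset js i"
  by (simp add: offset_def)

lemma locate_offset: "i < length js \<Longrightarrow> r < js ! i \<Longrightarrow> locate js (offset js i + r) = (i, r)"
proof (induction js arbitrary: i)
  case (Cons j js)
  then show ?case by (cases i) auto
qed simp

lemma offset_less: "i < length js \<Longrightarrow> r < js ! i \<Longrightarrow> offset js i + r < sum_list js"
proof (induction js arbitrary: i)
  case (Cons j js)
  then show ?case by (cases i) auto
qed simp

lemma offset_inject:
  "\<lbrakk>offset js i + r = offset js i' + r'; i < length js; r < js ! i; i' < length js; r' < js ! i'\<rbrakk> \<Longrightarrow>
    i = i' \<and> r = r'"
  by (metis locate_offset prod.inject)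

lemma offset_cases:
  assumes "u < sum_list js"
  obtains i r where "i < length js" "r < js ! i" "u = offset js i + r"
proof -
  have "\<exists>i r. i < length js \<and> r < js ! i \<and> u = offset js i + r"
    using assms
  proof (induction js arbitrary: u)
    case (Cons j js)
    show ?case
    proof (cases "u < j")
      case True
      then show ?thesis by (intro exI[of _ 0] exI[of _ u]) auto
    next
      case False
      with Cons.prems have "u - j < sum_list js" by auto
      then obtain i r where "i < length js" "r < js ! i" "u - j = offset js i + r"
        using Cons.IH by blast
      with False show ?thesis by (intro exI[of _ "Suc i"] exI[of _ r]) auto
    qed
  qed simp
  with that show ?thesis by blast
qed

lemma nth_concat_offset:
  "i < length xss \<Longrightarrow> r < length (xss ! i) \<Longrightarrow> concat xss ! (offset (map length xss) i + r) = xss ! i ! r"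
proof (induction xss arbitrary: i)
  case (Cons xs xss)
  then show ?case by (cases i) (auto simp: nth_append)
qed simp

text \<open>The arithmetic behind associativity of composition: the shifts of two successive
  substitutions add up to the shift for the flattened list.\<close>

lemma offset_concat:
  "i < length jss \<Longrightarrow> r < length (jss ! i) \<Longrightarrow>
    offset (concat jss) (offset (map length jss) i + r) = offset (map sum_list jss) i + offset (jss ! i) r"
proof (induction jss arbitrary: i)
  case (Cons js jss)
  then show ?case by (cases i) (auto simp: offset_def)
qed simp

text \<open>\<open>block_perm\<close> moves only numbers below \<open>sum_list js\<close>, whereas
  the offset on the left is bounded by the sum of the rearranged sizes; the last hypothesis
  identifies the two bounds.\<close>

lemma block_perm_offset:
  assumes "i < length js" "\<pi> i < length js" "r < js ! \<pi> i"
    and "sum_list (map (\<lambda>i. js ! \<pi> i) [0..<length js]) = sum_list js"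
  shows "block_perm js \<pi> (offset (map (\<lambda>i. js ! \<pi> i) [0..<length js]) i + r) = offset js (\<pi> i) + r"
  using assms offset_less[of i "map (\<lambda>i. js ! \<pi> i) [0..<length js]" r]
  by (simp add: block_perm_def locate_offset)

lemma sum_list_permute:
  assumes "\<pi> permutes {..<length js}"
  shows "sum_list (map (\<lambda>i. js ! \<pi> i) [0..<length js]) = (sum_list js :: nat)"
proof -
  have "sum_list (map (\<lambda>i. js ! \<pi> i) [0..<length js]) = (\<Sum>i<length js. js ! \<pi> i)"
    by (simp add: interv_sum_list_conv_sum_set_nat lessThan_atLeast0)
  also have "\<dots> = (\<Sum>i<length js. js ! i)"
    using sum.permute[OF assms, of "(!) js"] by (simp add: comp_def)
  also have "\<dots> = sum_list js"
    by (simp add: sum_list_sum_nth lessThan_atLeast0)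
  finally show ?thesis .
qed

lemma sum_perm_offset:
  "i < length js \<Longrightarrow> r < js ! i \<Longrightarrow> sum_perm js \<pi>s (offset js i + r) = offset js i + (\<pi>s ! i) r"
  using offset_less[of i js r] by (simp add: sum_perm_def locate_offset)

lemma distinct_concat_map:
  assumes "distinct xs" "\<And>x. x \<in> set xs \<Longrightarrow> distinct (f x)"
    and "\<And>x y. x \<in> set xs \<Longrightarrow> y \<in> set xs \<Longrightarrow> x \<noteq> y \<Longrightarrow> set (f x) \<inter> set (f y) = {}"
  shows "distinct (concat (map f xs))"
  using assms
proof (induction xs)
  case (Cons x xs)
  have "set (f x) \<inter> set (f y) = {}" if "y \<in> set xs" for y
    using Cons.prems(1) that by (intro Cons.prems(3)) auto
  with Cons show ?case by fastforce
qed simp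

section \<open>Closure of linear expressions and the operad laws for objects\<close>

lemma linear_exprsD:
  assumes "a \<in> linear_exprs I k"
  shows "a \<in> exprs I" "distinct (syms a)" "set (syms a) = {..<k}"
  using assms by (auto simp: linear_exprs_iff)

lemma expr_act_linear:
  assumes "\<pi> permutes {..<k}" "x \<in> linear_exprs I k"
  shows "expr_act k \<pi> x \<in> linear_exprs I k"
proof -
  have "inj_on \<pi> {..<k}" "\<pi> ` {..<k} = {..<k}"
    using assms(1) by (auto simp: permutes_image dest: permutes_inj intro: inj_on_subset)
  with assms(2) show ?thesis
    by (auto simp: linear_exprs_iff expr_act_def syms_relabel distinct_map
        intro!: subst_exprs exprs.intros)
qed

text \<open>The shifted blocks are disjoint by \<open>offset_inject\<close> and exhaust the range by
  \<open>offset_cases\<close>.\<close>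

lemma expr_mult_linear:
  assumes "x \<in> linear_exprs I (length js)"
    and "\<And>i. i < length js \<Longrightarrow> ys ! i \<in> linear_exprs I (js ! i)"
  shows "expr_mult js x ys \<in> linear_exprs I (sum_list js)"
proof -
  note x = linear_exprsD[OF assms(1)] and ys = linear_exprsD[OF assms(2)]
  let ?b = "\<lambda>q. map ((+) (offset js q)) (syms (ys ! q))"
  have syms: "syms (expr_mult js x ys) = concat (map ?b (syms x))"
    by (simp add: expr_mult_def syms_subst syms_relabel)
  have "distinct (syms (expr_mult js x ys))"
    unfolding syms using x ys
    by (intro distinct_concat_map) (auto simp: distinct_map dest: offset_inject)
  moreover have "set (syms (expr_mult js x ys)) = {..<sum_list js}"
    unfolding syms using x ys by (auto simp: offset_less elim!: offset_cases)
  moreover have "expr_mult js x ys \<in> exprs I"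
    unfolding expr_mult_def using x ys by (auto intro!: subst_exprs exprs.Sym)
  ultimately show ?thesis by (simp add: linear_exprs_iff)
qed

lemma Sym_0_linear: "Sym 0 \<in> linear_exprs I (Suc 0)"
  by (auto simp: linear_exprs_iff intro: exprs.Sym)

lemma expr_mult_one_left: "expr_mult [k] (Sym 0) [x] = x"
  by (simp add: expr_mult_def)

lemma offset_replicate_1: "i \<le> k \<Longrightarrow> offset (replicate k (Suc 0)) i = i"
  by (simp add: offset_def sum_list_replicate)

lemma expr_mult_one_right:
  assumes "x \<in> linear_exprs I k"
  shows "expr_mult (replicate k (Suc 0)) x (replicate k (Sym 0)) = x"
proof -
  have "expr_mult (replicate k (Suc 0)) x (replicate k (Sym 0)) = subst Sym x"
    unfolding expr_mult_def using linear_exprsD(3)[OF assms]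
    by (intro subst_cong) (simp add: offset_replicate_1)
  then show ?thesis by simp
qed

text \<open>Each law unfolds to an equation between iterated substitutions that is checked on the
  symbols that occur. Linearity bounds these by the arities, which brings them into the range of the
  formulas for \<open>offset\<close>, \<open>block_perm\<close> and \<open>sum_perm\<close>.\<close>

lemma symmetric_operad_exprs: "symmetric_operad (linear_exprs I) expr_act expr_mult (Sym 0)"
proof
  show "expr_act k \<pi> x \<in> linear_exprs I k" if "\<pi> permutes {..<k}" "x \<in> linear_exprs I k" for \<pi> k x
    using that by (rule expr_act_linear)
  show "expr_act k id x = x" for k x
    by (simp add: expr_act_def)
  show "expr_act k (\<pi> \<circ> \<rho>) x = expr_act k \<pi> (expr_act k \<rho> x)" for k \<pi> \<rho> x
    by (simp add: expr_act_def subst_subst)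
  show "expr_mult js x ys \<in> linear_exprs I (sum_list js)"
    if "x \<in> linear_exprs I (length js)" "list_all2 (\<lambda>j y. y \<in> linear_exprs I j) js ys" for js x ys
    using that by (auto intro: expr_mult_linear simp: list_all2_conv_all_nth)
  show "Sym 0 \<in> linear_exprs I 1"
    by (simp add: Sym_0_linear)
  show "expr_mult [k] (Sym 0) [x] = x" for k x
    by (rule expr_mult_one_left)
  show "expr_mult (replicate k 1) x (replicate k (Sym 0)) = x" if "x \<in> linear_exprs I k" for k x
    using expr_mult_one_right[OF that] by simp
next
  fix x ys and jss :: "nat list list" and zss
  assume x: "x \<in> linear_exprs I (length jss)" and len: "length ys = length jss" "length zss = length jss"
    and ys: "\<And>i. i < length jss \<Longrightarrow> ys ! i \<in> linear_exprs I (length (jss ! i))"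
    and zss: "\<And>i. i < length jss \<Longrightarrow> list_all2 (\<lambda>j z. z \<in> linear_exprs I j) (jss ! i) (zss ! i)"
  have "map length zss = map length jss"
    using len zss by (intro nth_equalityI) (simp_all add: list_all2_lengthD[OF zss])
  moreover from this have "length (zss ! q) = length (jss ! q)" if "q < length jss" for q
    using that len by (metis nth_map)
  ultimately show "expr_mult (concat jss) (expr_mult (map length jss) x ys) (concat zss) =
      expr_mult (map sum_list jss) x (map (\<lambda>i. expr_mult (jss ! i) (ys ! i) (zss ! i)) [0..<length jss])"
    using linear_exprsD(3)[OF x] linear_exprsD(3)[OF ys] len nth_concat_offset[of _ zss]
    by (auto simp: expr_mult_def subst_subst offset_concat add.assoc intro!: subst_cong)
next
  fix x js ys \<pi>
  assume x: "x \<in> linear_exprs I (length js)" and ys: "list_all2 (\<lambda>j y. y \<in> linear_exprs I j) js ys"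
    and \<pi>: "\<pi> permutes {..<length js}"
  have \<pi>_less: "\<pi> q < length js" if "q < length js" for q
    using permutes_in_image[OF \<pi>] that by simp
  have "set (syms (ys ! q)) = {..<js ! q}" if "q < length js" for q
    using ys that linear_exprsD(3) by (auto simp: list_all2_conv_all_nth)
  with \<pi>_less show "expr_mult js (expr_act (length js) \<pi> x) ys =
      expr_act (sum_list js) (block_perm js \<pi>)
        (expr_mult (map (\<lambda>i. js ! \<pi> i) [0..<length js]) x (map (\<lambda>i. ys ! \<pi> i) [0..<length js]))"
    using linear_exprsD(3)[OF x]
    by (auto simp: expr_mult_def expr_act_def subst_subst block_perm_offset sum_list_permute[OF \<pi>]
        intro!: subst_cong)
next
  fix x js ys and \<pi>s :: "(nat \<Rightarrow> nat) list"
  assume x: "x \<in> linear_exprs I (length js)" and ys: "list_all2 (\<lambda>j y. y \<in> linear_exprs I j) js ys"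
  have "set (syms (ys ! q)) = {..<js ! q}" if "q < length js" for q
    using ys that linear_exprsD(3) by (auto simp: list_all2_conv_all_nth)
  then show "expr_mult js x (map (\<lambda>i. expr_act (js ! i) (\<pi>s ! i) (ys ! i)) [0..<length js]) =
      expr_act (sum_list js) (sum_perm js \<pi>s) (expr_mult js x ys)"
    using linear_exprsD(3)[OF x]
    by (auto simp: expr_mult_def expr_act_def subst_subst sum_perm_offset intro!: subst_cong)
qed

section \<open>Monotonicity of action and composition, and the category structure\<close>

lemma expr_act_mono:
  assumes "\<pi> permutes {..<k}" "x \<in> linear_exprs I k" "y \<in> linear_exprs I k" "le_by lt x y"
  shows "le_by lt (expr_act k \<pi> x) (expr_act k \<pi> y)"
proof -
  have "le_links lt (expr_act k \<pi> x) (expr_act k \<pi> y)"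
    unfolding expr_act_def using assms
    by (intro le_links_relabel) (auto simp: le_by_iff_le_links[of _ I k] linear_exprs_iff)
  with assms show ?thesis
    by (simp add: le_by_iff_le_links[of _ I k] expr_act_linear)
qed

lemma expr_mult_mono:
  assumes x: "x \<in> linear_exprs I (length js)" "y \<in> linear_exprs I (length js)" "le_by lt x y"
    and xs: "\<And>i. i < length js \<Longrightarrow> xs ! i \<in> linear_exprs I (js ! i)"
      "\<And>i. i < length js \<Longrightarrow> ys ! i \<in> linear_exprs I (js ! i)"
      "\<And>i. i < length js \<Longrightarrow> le_by lt (xs ! i) (ys ! i)"
  shows "le_by lt (expr_mult js x xs) (expr_mult js y ys)"
proof -
  have "le_links lt (expr_mult js x xs) (expr_mult js y ys)"
    unfolding expr_mult_def
  proof (rule le_links_subst)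
    show "le_links lt x y"
      using x by (simp add: le_by_iff_le_links)
    show "set (syms x) = set (syms y)"
      using x by (simp add: linear_exprs_iff)
    fix q assume "q \<in> set (syms x)"
    then have q: "q < length js"
      using linear_exprsD(3)[OF x(1)] by simp
    have syms: "set (syms (xs ! q)) = set (syms (ys ! q))"
      using xs(1,2)[OF q] by (simp add: linear_exprs_iff)
    then show "set (syms (relabel ((+) (offset js q)) (xs ! q))) =
        set (syms (relabel ((+) (offset js q)) (ys ! q)))"
      by (simp add: syms_relabel)
    show "le_links lt (relabel ((+) (offset js q)) (xs ! q)) (relabel ((+) (offset js q)) (ys ! q))"
      using le_by_iff_le_links xs[OF q] syms by (blast intro: le_links_relabel)
  qed
  with x xs show ?thesis
    by (simp add: le_by_iff_le_links[of _ I "sum_list js"] expr_mult_linear)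
qed

text \<open>A morphism is the pair of its ends, so a law for morphisms is two copies of the law for
  objects. What remains is that the order is closed under composition, by transitivity of
  \<open>lt\<close>, and under action and multiplication.\<close>

lemma categorical_expr_operad:
  assumes "transp lt"
  shows "categorical_symmetric_operad (expr_operad I (le_by lt))"
proof -
  interpret symmetric_operad "linear_exprs I" expr_act expr_mult "Sym 0"
    by (rule symmetric_operad_exprs)
  let ?A = "expr_operad I (le_by lt)"
  have pairs: "list_all2 (\<lambda>j f. f \<in> Mor ?A j) js fs \<longleftrightarrow> length fs = length js \<and>
      (\<forall>i<length js. fst (fs ! i) \<in> linear_exprs I (js ! i) \<and> snd (fs ! i) \<in> linear_exprs I (js ! i) \<and>
        le_by lt (fst (fs ! i)) (snd (fs ! i)))" for js fs
    by (auto simp: list_all2_conv_all_nth expr_operad_def case_prod_beta)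
  show ?thesis
  proof (rule categorical_symmetric_operad.intro)
    show "symmetric_operad (Obj ?A) (ActObj ?A) (MultObj ?A) (UnitObj ?A)"
      by (simp add: expr_operad_def symmetric_operad_exprs)
    have "symmetric_operad (Mor ?A) (ActMor ?A) (MultMor ?A) (Sym 0, Sym 0)"
    proof (rule symmetric_operad.intro, unfold pairs)
      fix x k
      show "MultMor ?A (replicate k 1) x (replicate k (Sym 0, Sym 0)) = x" if "x \<in> Mor ?A k"
        using that by (auto simp: expr_operad_def expr_mult_one_right)
    next
      fix x ys and jss :: "nat list list" and zss
      assume *: "x \<in> Mor ?A (length jss)" "length ys = length jss" "length zss = length jss"
        "\<And>i. i < length jss \<Longrightarrow> ys ! i \<in> Mor ?A (length (jss ! i))"
        "\<And>i. i < length jss \<Longrightarrow> length (zss ! i) = length (jss ! i) \<and>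
          (\<forall>j<length (jss ! i). fst (zss ! i ! j) \<in> linear_exprs I (jss ! i ! j) \<and>
            snd (zss ! i ! j) \<in> linear_exprs I (jss ! i ! j) \<and>
            le_by lt (fst (zss ! i ! j)) (snd (zss ! i ! j)))"
      \<comment> \<open>Projection of a list of pairs commutes with indexing below its length. This
        fact and its analogues below bring the projected terms into the shape of the laws for
        objects.\<close>
      have eq: "map (\<lambda>i. expr_mult (jss ! i) (map h ys ! i) (map (map h) zss ! i)) [0..<length jss] =
          map (\<lambda>i. expr_mult (jss ! i) (h (ys ! i)) (map h (zss ! i))) [0..<length jss]"
        for h :: "expr \<times> expr \<Rightarrow> expr"
        using *(2,3) by simp
      show "MultMor ?A (concat jss) (MultMor ?A (map length jss) x ys) (concat zss) =
          MultMor ?A (map sum_list jss) x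
            (map (\<lambda>i. MultMor ?A (jss ! i) (ys ! i) (zss ! i)) [0..<length jss])"
        using * mult_assoc[of "fst x" jss "map fst ys" "map (map fst) zss"]
          mult_assoc[of "snd x" jss "map snd ys" "map (map snd) zss"]
        by (auto simp: expr_operad_def map_concat comp_def list_all2_conv_all_nth case_prod_beta eq)
    next
      fix x js ys and \<pi> :: "nat \<Rightarrow> nat"
      assume *: "x \<in> Mor ?A (length js)" "\<pi> permutes {..<length js}"
        "length ys = length js \<and> (\<forall>i<length js. fst (ys ! i) \<in> linear_exprs I (js ! i) \<and>
          snd (ys ! i) \<in> linear_exprs I (js ! i) \<and> le_by lt (fst (ys ! i)) (snd (ys ! i)))"
      have "i < length js \<Longrightarrow> \<pi> i < length js" for i
        using permutes_in_image[OF *(2), of i] by simp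
      then have eq: "map (\<lambda>i. map h ys ! \<pi> i) [0..<length js] = map (\<lambda>i. h (ys ! \<pi> i)) [0..<length js]"
        for h :: "expr \<times> expr \<Rightarrow> expr"
        using *(3) by simp
      show "MultMor ?A js (ActMor ?A (length js) \<pi> x) ys =
          ActMor ?A (sum_list js) (block_perm js \<pi>)
            (MultMor ?A (map (\<lambda>i. js ! \<pi> i) [0..<length js]) x (map (\<lambda>i. ys ! \<pi> i) [0..<length js]))"
        using * mult_act_outer[of "fst x" js "map fst ys" \<pi>] mult_act_outer[of "snd x" js "map snd ys" \<pi>]
        by (auto simp: expr_operad_def comp_def list_all2_conv_all_nth case_prod_beta eq)
    next
      fix x js ys and \<pi>s :: "(nat \<Rightarrow> nat) list"
      assume *: "x \<in> Mor ?A (length js)" "length \<pi>s = length js"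
        "\<And>i. i < length js \<Longrightarrow> (\<pi>s ! i) permutes {..<js ! i}"
        "length ys = length js \<and> (\<forall>i<length js. fst (ys ! i) \<in> linear_exprs I (js ! i) \<and>
          snd (ys ! i) \<in> linear_exprs I (js ! i) \<and> le_by lt (fst (ys ! i)) (snd (ys ! i)))"
      have eq: "map (\<lambda>i. expr_act (js ! i) (\<pi>s ! i) (map h ys ! i)) [0..<length js] =
          map (\<lambda>i. expr_act (js ! i) (\<pi>s ! i) (h (ys ! i))) [0..<length js]"
        for h :: "expr \<times> expr \<Rightarrow> expr"
        using *(4) by simp
      show "MultMor ?A js x (map (\<lambda>i. ActMor ?A (js ! i) (\<pi>s ! i) (ys ! i)) [0..<length js]) =
          ActMor ?A (sum_list js) (sum_perm js \<pi>s) (MultMor ?A js x ys)"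
        using * mult_act_inner[of "fst x" js "map fst ys" \<pi>s] mult_act_inner[of "snd x" js "map snd ys" \<pi>s]
        by (auto simp: expr_operad_def comp_def list_all2_conv_all_nth case_prod_beta eq)
    qed (auto simp: expr_operad_def expr_act_linear expr_mult_linear expr_act_mono act_comp act_id
        Sym_0_linear le_by_refl expr_mult_one_left intro: expr_mult_mono)
    then show "symmetric_operad (Mor ?A) (ActMor ?A) (MultMor ?A) (Ident ?A 1 (UnitObj ?A))"
      by (simp add: expr_operad_def)
  next
    fix f x y js fs xs ys
    assume f: "f \<in> Hom ?A (length js) x y" and len: "length fs = length js" "length xs = length js"
      "length ys = length js" and fs: "\<And>i. i < length js \<Longrightarrow> fs ! i \<in> Hom ?A (js ! i) (xs ! i) (ys ! i)"
    have "fst (fs ! i) = xs ! i" "snd (fs ! i) = ys ! i" if "i < length js" for i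
      using fs[OF that] by (auto simp: Hom_def expr_operad_def)
    with len have "map fst fs = xs" "map snd fs = ys"
      by (auto intro: nth_equalityI)
    with f fs len show "MultMor ?A js f fs \<in> Hom ?A (sum_list js) (MultObj ?A js x xs) (MultObj ?A js y ys)"
      by (auto simp: expr_operad_def Hom_def case_prod_beta intro!: expr_mult_linear expr_mult_mono)
  next
    fix x js ys
    assume "list_all2 (\<lambda>j y. y \<in> Obj ?A j) js ys"
    then have "length js = length ys"
      by (rule list_all2_lengthD)
    then show "MultMor ?A js (Ident ?A (length js) x) (map (\<lambda>i. Ident ?A (js ! i) (ys ! i)) [0..<length js]) =
        Ident ?A (sum_list js) (MultObj ?A js x ys)"
      by (simp add: expr_operad_def comp_def map_nth)
  next
    fix f g and js :: "nat list" and fs gs :: "(expr \<times> expr) list"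
    assume "length fs = length js" "length gs = length js"
    then have "map (\<lambda>i. fst (fs ! i)) [0..<length js] = map fst fs"
      "map (\<lambda>i. snd (gs ! i)) [0..<length js] = map snd gs"
      by (auto intro: nth_equalityI)
    then show "MultMor ?A js (Comp ?A (length js) g f)
        (map (\<lambda>i. Comp ?A (js ! i) (gs ! i) (fs ! i)) [0..<length js]) =
      Comp ?A (sum_list js) (MultMor ?A js g gs) (MultMor ?A js f fs)"
      by (simp add: expr_operad_def comp_def)
  qed (auto simp: expr_operad_def Hom_def le_by_refl expr_act_linear intro: le_by_trans[OF assms]
      expr_act_mono)
qed

text \<open>A functor is also a functor between the opposite categories, and the operads of objects
  and of morphisms in sets stay the same.\<close>

lemma categorical_opposite:
  assumes "categorical_symmetric_operad A"
  shows "categorical_symmetric_operad (opposite A)"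
proof -
  interpret categorical_symmetric_operad A by fact
  have Hom: "Hom (opposite A) k x y = Hom A k y x" for k x y
    by (auto simp: Hom_def opposite_def)
  show ?thesis
  proof (rule categorical_symmetric_operad.intro, unfold Hom)
    show "symmetric_operad (Obj (opposite A)) (ActObj (opposite A)) (MultObj (opposite A)) (UnitObj (opposite A))"
      using objects_operad by (simp add: opposite_def)
    show "symmetric_operad (Mor (opposite A)) (ActMor (opposite A)) (MultMor (opposite A))
        (Ident (opposite A) 1 (UnitObj (opposite A)))"
      using morphisms_operad by (simp add: opposite_def)
  qed (auto simp: opposite_def Dom_closed Cod_closed Ident_Hom Comp_Hom Comp_Ident_left
      Comp_Ident_right Comp_assoc Act_Hom Act_Ident Act_Comp Mult_Hom Mult_Ident Mult_Comp)
qed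

section \<open>The sorting permutation\<close>

definition preimages :: "nat list \<Rightarrow> nat \<Rightarrow> nat list" where
  "preimages \<tau> i = filter (\<lambda>x. \<tau> ! x = i) [0..<length \<tau>]"

text \<open>The inverse of \<pi>(\<tau>) as a list of values: if k bounds the values of \<tau>, the
  q-th entry is the element that \<pi>(\<tau>) sends to q. Empty fibres contribute nothing.\<close>

definition sorting :: "nat list \<Rightarrow> nat \<Rightarrow> nat list" where
  "sorting \<tau> k = concat (map (preimages \<tau>) [0..<k])"

lemma distinct_preimages [simp]: "distinct (preimages \<tau> i)"
  by (simp add: preimages_def)

lemma set_preimages: "set (preimages \<tau> i) = {x. x < length \<tau> \<and> \<tau> ! x = i}"
  by (auto simp: preimages_def)

lemma distinct_sorting: "distinct (sorting \<tau> k)"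
  unfolding sorting_def by (rule distinct_concat_map) (auto simp: set_preimages)

lemma set_sorting:
  assumes "\<And>x. x < length \<tau> \<Longrightarrow> \<tau> ! x < k"
  shows "set (sorting \<tau> k) = {..<length \<tau>}"
  using assms by (auto simp: sorting_def set_preimages)

lemma length_sorting:
  assumes "\<And>x. x < length \<tau> \<Longrightarrow> \<tau> ! x < k"
  shows "length (sorting \<tau> k) = length \<tau>"
  using set_sorting[OF assms] distinct_card[OF distinct_sorting[of \<tau> k]] by simp

lemma sorted_wrt_sorting:
  "sorted_wrt (\<lambda>x y. \<tau> ! x < \<tau> ! y \<or> \<tau> ! x = \<tau> ! y \<and> x < y) (sorting \<tau> k)"
proof (induction k)
  case (Suc k)
  have "sorted_wrt (<) (preimages \<tau> k)"
    unfolding preimages_def by (intro sorted_wrt_filter) simp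
  then have "sorted_wrt (\<lambda>x y. \<tau> ! x < \<tau> ! y \<or> \<tau> ! x = \<tau> ! y \<and> x < y) (preimages \<tau> k)"
    by (rule sorted_wrt_mono_rel[rotated]) (auto simp: set_preimages)
  with Suc show ?case
    by (auto simp: sorting_def sorted_wrt_append set_preimages)
qed (simp add: sorting_def)

text \<open>The list \<open>sorting\<close> increases lexicographically by value and then by
  element. Any candidate for \<pi>(\<tau>) increases along it, hence maps it to 0, 1, 2 and so on,
  which gives uniqueness. The inverse of the list is a candidate, so the definite description
  denotes.\<close>

lemma sort_perm_sorting:
  assumes bound: "\<And>x. x < length \<tau> \<Longrightarrow> \<tau> ! x < k"
  shows sort_perm_permutes: "sort_perm \<tau> permutes {..<length \<tau>}"
    and sort_perm_nth: "\<And>q. q < length \<tau> \<Longrightarrow> sort_perm \<tau> (sorting \<tau> k ! q) = q"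
proof -
  define p L where "p = length \<tau>" and "L = sorting \<tau> k"
  define Q where "Q \<pi> \<longleftrightarrow> \<pi> permutes {..<p} \<and>
     (\<exists>\<nu> :: nat \<Rightarrow> nat. mono_on {..<p} \<nu> \<and> (\<forall>x<p. \<tau> ! x = \<nu> (\<pi> x))) \<and>
     (\<forall>x y. x < y \<and> y < p \<and> \<tau> ! x = \<tau> ! y \<longrightarrow> \<pi> x < \<pi> y)" for \<pi> :: "nat \<Rightarrow> nat"
  have L: "distinct L" "set L = {..<p}" "length L = p"
    unfolding L_def p_def using bound distinct_sorting set_sorting length_sorting by blast+
  have L_less: "\<tau> ! (L ! q) < \<tau> ! (L ! q') \<or> \<tau> ! (L ! q) = \<tau> ! (L ! q') \<and> L ! q < L ! q'"
    if "q < q'" "q' < p" for q q'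
    using sorted_wrt_nth_less[OF sorted_wrt_sorting, of q q' \<tau> k] that L(3) by (auto simp: L_def)
  have inv_L: "\<pi> (L ! q) = q" if "Q \<pi>" "q < p" for \<pi> q
  proof -
    from \<open>Q \<pi>\<close> obtain \<nu> :: "nat \<Rightarrow> nat" where \<pi>: "\<pi> permutes {..<p}" and \<nu>: "mono_on {..<p} \<nu>"
      "\<And>x. x < p \<Longrightarrow> \<tau> ! x = \<nu> (\<pi> x)" and stable: "\<And>x y. \<lbrakk>x < y; y < p; \<tau> ! x = \<tau> ! y\<rbrakk> \<Longrightarrow> \<pi> x < \<pi> y"
      unfolding Q_def by blast
    have \<pi>_less: "\<pi> x < p" if "x < p" for x
      using permutes_in_image[OF \<pi>, of x] that by simp
    have "\<pi> x < \<pi> y" if "\<tau> ! x < \<tau> ! y" "x < p" "y < p" for x y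
    proof (rule ccontr)
      assume "\<not> \<pi> x < \<pi> y"
      then have "\<nu> (\<pi> y) \<le> \<nu> (\<pi> x)"
        using \<pi>_less that by (intro mono_onD[OF \<nu>(1)]) auto
      with that \<nu>(2) show False by simp
    qed
    moreover have "L ! q < p" if "q < p" for q
      using that L nth_mem by fastforce
    ultimately have "\<pi> (L ! q) < \<pi> (L ! q')" if "q < q'" "q' < p" for q q'
      using L_less[OF that] stable that by (meson less_trans)
    then have "sorted_wrt (<) (map \<pi> L)"
      by (simp add: sorted_wrt_iff_nth_less L)
    moreover have "set (map \<pi> L) = set [0..<p]"
      using L(2) permutes_image[OF \<pi>] by (simp add: lessThan_atLeast0)
    ultimately have "map \<pi> L = [0..<p]"
      by (intro sorted_distinct_set_unique) (auto simp: strict_sorted_iff)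
    then have "map \<pi> L ! q = [0..<p] ! q"
      by simp
    with \<open>q < p\<close> L(3) show ?thesis by simp
  qed
  \<comment> \<open>The list is extended by the identity because \<open>permutes\<close> demands
    that outside points be fixed.\<close>
  define \<rho> where "\<rho> q = (if q < p then L ! q else q)" for q
  have "bij_betw ((!) L) {..<p} {..<p}"
    using bij_betw_nth[OF L(1)] L by simp
  then have "bij_betw \<rho> {..<p} {..<p}"
    by (rule bij_betw_cong[THEN iffD1, rotated]) (simp add: \<rho>_def)
  then have \<rho>: "\<rho> permutes {..<p}"
    by (rule bij_imp_permutes) (simp add: \<rho>_def)
  have inv_less: "inv \<rho> x < p" if "x < p" for x
    using permutes_in_image[OF permutes_inv[OF \<rho>], of x] that by simp
  have L_inv: "L ! inv \<rho> x = x" if "x < p" for x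
    using inv_less[OF that] permutes_inverses(1)[OF \<rho>, of x] by (simp add: \<rho>_def)
  have "Q (inv \<rho>)"
    unfolding Q_def
  proof (intro conjI exI allI impI)
    show "inv \<rho> permutes {..<p}"
      by (rule permutes_inv[OF \<rho>])
    show "mono_on {..<p} (\<lambda>q. \<tau> ! (L ! q))"
      using L_less by (intro mono_onI) (metis le_less lessThan_iff)
    show "\<tau> ! x = \<tau> ! (L ! inv \<rho> x)" if "x < p" for x
      using L_inv[OF that] by simp
    fix x y assume xy: "x < y \<and> y < p \<and> \<tau> ! x = \<tau> ! y"
    then have "L ! inv \<rho> x = x" "L ! inv \<rho> y = y" "inv \<rho> x < p"
      using L_inv inv_less by auto
    with xy L_less[of "inv \<rho> y" "inv \<rho> x"] show "inv \<rho> x < inv \<rho> y"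
      by (metis linorder_neqE_nat order_less_asym)
  qed
  moreover have "\<pi> = inv \<rho>" if "Q \<pi>" for \<pi>
  proof
    fix x
    show "\<pi> x = inv \<rho> x"
    proof (cases "x < p")
      case True
      with inv_L[OF that] L_inv inv_less show ?thesis by metis
    next
      case False
      with that show ?thesis
        by (simp add: Q_def permutes_not_in[of _ "{..<p}"] permutes_not_in[OF permutes_inv[OF \<rho>]])
    qed
  qed
  ultimately have "Q (THE \<pi>. Q \<pi>)"
    by (rule theI)
  also have "(THE \<pi>. Q \<pi>) = sort_perm \<tau>"
    unfolding sort_perm_def Q_def p_def ..
  finally have "Q (sort_perm \<tau>)" .
  then show "sort_perm \<tau> permutes {..<length \<tau>}"
    and "\<And>q. q < length \<tau> \<Longrightarrow> sort_perm \<tau> (sorting \<tau> k ! q) = q"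
    using inv_L unfolding p_def L_def by (auto simp: Q_def p_def)
qed

text \<open>This puts \<pi>(\<tau>) into the block form in which \<open>block_perm\<close> and
  \<open>sum_perm\<close> can be evaluated.\<close>

lemma sort_perm_offset:
  assumes "\<And>x. x < length \<tau> \<Longrightarrow> \<tau> ! x < k" "i < k" "r < length (preimages \<tau> i)"
  shows "sort_perm \<tau> (preimages \<tau> i ! r) = offset (map (length \<circ> preimages \<tau>) [0..<k]) i + r"
proof -
  let ?q = "offset (map (length \<circ> preimages \<tau>) [0..<k]) i + r"
  have "sorting \<tau> k ! ?q = preimages \<tau> i ! r"
    using nth_concat_offset[of i "map (preimages \<tau>) [0..<k]" r] assms(2,3)
    by (simp add: sorting_def)
  moreover have "?q < length (sorting \<tau> k)"
    using offset_less[of i "map (length \<circ> preimages \<tau>) [0..<k]" r] assms(2,3)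
    by (simp add: sorting_def length_concat comp_def)
  ultimately show ?thesis
    using sort_perm_nth[OF assms(1)] length_sorting[OF assms(1)] by metis
qed

text \<open>Used for the unit equations, where the map on tips is constant or the identity.\<close>

lemma sort_perm_mono:
  assumes "sorted \<tau>"
  shows "sort_perm \<tau> x = x"
proof -
  obtain k where k: "\<And>x. x < length \<tau> \<Longrightarrow> \<tau> ! x < k"
    by (metis finite_set finite_nat_set_iff_bounded nth_mem)
  note L = set_sorting[OF k] length_sorting[OF k]
  have "sorting \<tau> k = [0..<length \<tau>]"
  proof (rule sorted_distinct_set_unique)
    have "sorting \<tau> k ! q \<le> sorting \<tau> k ! q'" if "q < q'" "q' < length \<tau>" for q q'
    proof (rule ccontr)
      assume "\<not> sorting \<tau> k ! q \<le> sorting \<tau> k ! q'"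
      moreover have "sorting \<tau> k ! q < length \<tau>"
        using L that nth_mem[of q "sorting \<tau> k"] by simp
      ultimately have "\<tau> ! (sorting \<tau> k ! q') \<le> \<tau> ! (sorting \<tau> k ! q)"
        by (intro sorted_nth_mono[OF assms]) auto
      with sorted_wrt_nth_less[OF sorted_wrt_sorting, of q q' \<tau> k] that L
        \<open>\<not> sorting \<tau> k ! q \<le> sorting \<tau> k ! q'\<close> show False by auto
    qed
    then show "sorted (sorting \<tau> k)"
      by (simp add: sorted_wrt_iff_nth_less L)
  qed (auto simp: L distinct_sorting)
  then show ?thesis
    using sort_perm_nth[OF k, of x] permutes_not_in[OF sort_perm_permutes[OF k]]
    by (cases "x < length \<tau>") auto
qed

section \<open>Trees\<close>

lemma width_0 [simp]: "width T 0 = 1"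
  by (simp add: width_def)

lemma width_Suc [simp]: "width T (Suc m) = length (T ! m)"
  by (simp add: width_def)

lemma is_treeD:
  assumes "is_tree n T"
  shows "length T = n" "tips T = width T n" "m < n \<Longrightarrow> sorted (T ! m)"
    "m < n \<Longrightarrow> x < length (T ! m) \<Longrightarrow> T ! m ! x < width T m"
  using assms by (auto simp: is_tree_def tips_def)

lemma tree_homD:
  assumes "\<sigma> \<in> tree_hom n T S"
  shows "is_tree n T" "is_tree n S" "length \<sigma> = Suc n"
    "m \<le> n \<Longrightarrow> length (\<sigma> ! m) = width T m"
    "m \<le> n \<Longrightarrow> x < width T m \<Longrightarrow> \<sigma> ! m ! x < width S m"
    "m < n \<Longrightarrow> x < length (T ! m) \<Longrightarrow> S ! m ! (\<sigma> ! Suc m ! x) = \<sigma> ! m ! (T ! m ! x)"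
    "m < n \<Longrightarrow> x \<le> y \<Longrightarrow> y < length (T ! m) \<Longrightarrow> T ! m ! x = T ! m ! y \<Longrightarrow>
      \<sigma> ! Suc m ! x \<le> \<sigma> ! Suc m ! y"
  using assms by (auto simp: tree_hom_def)

lemma ancestor_length [simp]: "ancestor T (length T) i = i"
  by (simp add: ancestor_def)

lemma ancestor_Suc: "m < length T \<Longrightarrow> ancestor T m i = T ! m ! ancestor T (Suc m) i"
  by (simp add: ancestor_def upt_conv_Cons)

lemma ancestor_less:
  assumes "is_tree n T" "i < tips T" "m \<le> n"
  shows "ancestor T m i < width T m"
  using assms(3)
proof (induction rule: inc_induct)
  case base
  with assms show ?case by (metis ancestor_length is_treeD(1,2))
next
  case (step m)
  with assms(1) show ?case by (simp add: ancestor_Suc is_treeD)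
qed

lemma ancestor_0: "is_tree n T \<Longrightarrow> i < tips T \<Longrightarrow> ancestor T 0 i = 0"
  using ancestor_less[of n T i 0] by simp

text \<open>Induction from the tips down to the root, with one commuting square of the morphism at
  each level.\<close>

lemma tree_hom_ancestor:
  assumes "\<sigma> \<in> tree_hom n T S" "u < tips T" "m \<le> n"
  shows "\<sigma> ! m ! ancestor T m u = ancestor S m (\<sigma> ! n ! u)"
  using assms(3)
proof (induction rule: inc_induct)
  case base
  show ?case using tree_homD[OF assms(1)] by (metis ancestor_length is_treeD(1))
next
  case (step m)
  note T = tree_homD(1)[OF assms(1)] and S = tree_homD(2)[OF assms(1)]
  have "ancestor T (Suc m) u < length (T ! m)"
    using ancestor_less[OF T assms(2), of "Suc m"] step by simp
  with step show ?case
    by (simp add: ancestor_Suc is_treeD(1)[OF T] is_treeD(1)[OF S] tree_homD(6)[OF assms(1), symmetric])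
qed

lemma ancestor_eq_mono:
  assumes "ancestor T m u = ancestor T m v" "l \<le> m" "m \<le> length T"
  shows "ancestor T l u = ancestor T l v"
  using assms(2,1,3)
proof (induction rule: inc_induct)
  case (step m)
  then show ?case by (simp add: ancestor_Suc)
qed

lemma meet_level:
  assumes "is_tree n T" "u < tips T" "v < tips T" "u \<noteq> v"
  obtains m where "m < n" "ancestor T m u = ancestor T m v" "ancestor T (Suc m) u \<noteq> ancestor T (Suc m) v"
proof -
  have len: "length T = n"
    using assms(1) by (rule is_treeD)
  let ?P = "\<lambda>m. ancestor T m u = ancestor T m v"
  \<comment> \<open>The first level in which the ancestors differ. It is not 0, as level 0 is a
    single vertex, and it is at most n, as the tips differ; the meeting level is its
    predecessor.\<close>
  define l where "l = (LEAST l. \<not> ?P l)"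
  have "\<not> ?P n"
    using assms(4) len ancestor_length by metis
  then have l: "\<not> ?P l" "l \<le> n"
    unfolding l_def using LeastI[of "\<lambda>l. \<not> ?P l" n] Least_le[of "\<lambda>l. \<not> ?P l" n] by auto
  moreover have "?P 0"
    using assms by (simp add: ancestor_0)
  ultimately obtain m where m: "l = Suc m"
    by (cases l) auto
  then have "?P m"
    unfolding l_def using not_less_Least[of m "\<lambda>l. \<not> ?P l"] by auto
  with l m show ?thesis by (intro that[of m]) auto
qed

section \<open>Fibres and their inclusion into the tree\<close>

lemma rank_nth: "sorted_wrt (<) xs \<Longrightarrow> k < length xs \<Longrightarrow> rank xs (xs ! k) = k"
proof (induction xs arbitrary: k)
  case (Cons x xs)
  show ?case
  proof (cases k)
    case 0
    with Cons.prems show ?thesis by (auto simp: rank_def filter_empty_conv)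
  next
    case (Suc k')
    with Cons.prems have "x < xs ! k'" by simp
    with Cons Suc show ?thesis by (simp add: rank_def)
  qed
qed simp

lemma nth_rank:
  assumes "sorted_wrt (<) xs" "x \<in> set xs"
  shows "rank xs x < length xs" "xs ! rank xs x = x"
  using assms rank_nth by (auto simp: in_set_conv_nth)

lemma rank_mono: "x \<le> y \<Longrightarrow> rank xs x \<le> rank xs y"
proof -
  assume "x \<le> y"
  then have "filter (\<lambda>z. z < x) xs = filter (\<lambda>z. z < x) (filter (\<lambda>z. z < y) xs)"
    by (auto intro: filter_cong)
  then show ?thesis
    unfolding rank_def by (metis length_filter_le)
qed

lemma sorted_fibre_vertices [simp]: "sorted_wrt (<) (fibre_vertices T S \<sigma> i m)"
  unfolding fibre_vertices_def by (intro sorted_wrt_filter) simp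

lemma set_fibre_vertices:
  "set (fibre_vertices T S \<sigma> i m) = {x. x < width T m \<and> \<sigma> ! m ! x = ancestor S m i}"
  by (auto simp: fibre_vertices_def)

lemma fibre_vertices_nth:
  assumes "k < length (fibre_vertices T S \<sigma> i m)"
  shows "fibre_vertices T S \<sigma> i m ! k < width T m" "\<sigma> ! m ! (fibre_vertices T S \<sigma> i m ! k) = ancestor S m i"
  using nth_mem[OF assms] by (auto simp: set_fibre_vertices)

lemma fibre_vertices_tips:
  assumes "\<sigma> \<in> tree_hom n T S"
  shows "fibre_vertices T S \<sigma> i n = preimages (\<sigma> ! n) i"
  using tree_homD(4)[OF assms, of n] is_treeD(1)[OF tree_homD(2)[OF assms]] ancestor_length[of S i]
  by (simp add: fibre_vertices_def preimages_def)

lemma fibre_vertices_root: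
  assumes "\<sigma> \<in> tree_hom n T S" "i < tips S"
  shows "fibre_vertices T S \<sigma> i 0 = [0]"
  using tree_homD(5)[OF assms(1), of 0 0] ancestor_0[OF tree_homD(2)[OF assms(1)] assms(2)]
  by (simp add: fibre_vertices_def)

lemma length_fibre [simp]: "length (fibre T S \<sigma> i) = length T"
  by (simp add: fibre_def)

lemma width_fibre:
  assumes "\<sigma> \<in> tree_hom n T S" "i < tips S" "m \<le> n"
  shows "width (fibre T S \<sigma> i) m = length (fibre_vertices T S \<sigma> i m)"
  using fibre_vertices_root[OF assms(1,2)] assms(3) is_treeD(1)[OF tree_homD(1)[OF assms(1)]]
  by (cases m) (auto simp: fibre_def)

lemma fibre_parent:
  assumes "\<sigma> \<in> tree_hom n T S" "i < tips S" "m < n" "x \<in> set (fibre_vertices T S \<sigma> i (Suc m))"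
  shows "T ! m ! x \<in> set (fibre_vertices T S \<sigma> i m)"
proof -
  note T = tree_homD(1)[OF assms(1)] and S = tree_homD(2)[OF assms(1)]
  have "ancestor S m i = S ! m ! ancestor S (Suc m) i"
    using assms(3) is_treeD(1)[OF S] by (simp add: ancestor_Suc)
  with assms(3,4) show ?thesis
    using tree_homD(6)[OF assms(1,3), of x] is_treeD(4)[OF T] by (auto simp: set_fibre_vertices)
qed

text \<open>Indexing \<open>fibre_vertices\<close> is the inclusion of the fibre into T. Its
  compatibility with the structure maps replaces the formula with \<open>rank\<close> in most later
  arguments.\<close>

lemma fibre_nth:
  assumes "\<sigma> \<in> tree_hom n T S" "i < tips S" "m < n" "x < length (fibre_vertices T S \<sigma> i (Suc m))"
  shows "fibre T S \<sigma> i ! m ! x < length (fibre_vertices T S \<sigma> i m)"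
    "fibre_vertices T S \<sigma> i m ! (fibre T S \<sigma> i ! m ! x) = T ! m ! (fibre_vertices T S \<sigma> i (Suc m) ! x)"
proof -
  have "fibre T S \<sigma> i ! m ! x = rank (fibre_vertices T S \<sigma> i m) (T ! m ! (fibre_vertices T S \<sigma> i (Suc m) ! x))"
    using assms is_treeD(1)[OF tree_homD(1)[OF assms(1)]] by (simp add: fibre_def)
  with fibre_parent[OF assms(1-3) nth_mem[OF assms(4)]]
  show "fibre T S \<sigma> i ! m ! x < length (fibre_vertices T S \<sigma> i m)"
    "fibre_vertices T S \<sigma> i m ! (fibre T S \<sigma> i ! m ! x) = T ! m ! (fibre_vertices T S \<sigma> i (Suc m) ! x)"
    by (simp_all add: nth_rank)
qed

lemma fibre_vertices_le:
  "x \<le> y \<Longrightarrow> y < length (fibre_vertices T S \<sigma> i m) \<Longrightarrow>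
    fibre_vertices T S \<sigma> i m ! x \<le> fibre_vertices T S \<sigma> i m ! y"
  by (metis le_less sorted_fibre_vertices sorted_wrt_nth_less)

lemma is_tree_fibre:
  assumes "\<sigma> \<in> tree_hom n T S" "i < tips S"
  shows "is_tree n (fibre T S \<sigma> i)"
proof -
  let ?F = "fibre T S \<sigma> i" and ?V = "fibre_vertices T S \<sigma> i"
  note T = tree_homD(1)[OF assms(1)]
  have len: "length (?F ! m) = length (?V (Suc m))" if "m < n" for m
    using width_fibre[OF assms, of "Suc m"] that by simp
  have "sorted (?F ! m)" if "m < n" for m
    unfolding sorted_iff_nth_mono
  proof (intro allI impI)
    fix x y assume xy: "x \<le> y" "y < length (?F ! m)"
    then have "T ! m ! (?V (Suc m) ! x) \<le> T ! m ! (?V (Suc m) ! y)"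
      using that len fibre_vertices_nth[of y T S \<sigma> i "Suc m"] is_treeD(3)[OF T]
      by (intro sorted_nth_mono fibre_vertices_le) auto
    then have "rank (?V m) (T ! m ! (?V (Suc m) ! x)) \<le> rank (?V m) (T ! m ! (?V (Suc m) ! y))"
      by (rule rank_mono)
    with xy that len is_treeD(1)[OF T] show "?F ! m ! x \<le> ?F ! m ! y"
      by (simp add: fibre_def)
  qed
  moreover have "x < width ?F m" if "m < n" "x \<in> set (?F ! m)" for m x
    using that len fibre_nth(1)[OF assms] width_fibre[OF assms] by (auto simp: in_set_conv_nth)
  ultimately show ?thesis
    using is_treeD(1)[OF T] by (simp add: is_tree_def)
qed

lemma tips_fibre:
  assumes "\<sigma> \<in> tree_hom n T S" "i < tips S"
  shows "tips (fibre T S \<sigma> i) = length (preimages (\<sigma> ! n) i)"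
  using is_treeD(2)[OF is_tree_fibre[OF assms]] width_fibre[OF assms, of n]
  by (simp add: fibre_vertices_tips[OF assms(1)])

section \<open>Composites and the induced maps between fibres\<close>

lemma tree_comp_nth:
  assumes "\<sigma> \<in> tree_hom n T S" "m \<le> n" "x < width T m"
  shows "tree_comp \<omega> \<sigma> ! m ! x = \<omega> ! m ! (\<sigma> ! m ! x)"
  using assms tree_homD(3,4)[OF assms(1)] by (simp add: tree_comp_def del: upt_Suc)

lemma tree_comp_hom:
  assumes \<sigma>: "\<sigma> \<in> tree_hom n T S" and \<omega>: "\<omega> \<in> tree_hom n S R"
  shows "tree_comp \<omega> \<sigma> \<in> tree_hom n T R"
proof -
  note T = tree_homD(1)[OF \<sigma>] and nth = tree_comp_nth[OF \<sigma>]
  have Suc_nth: "tree_comp \<omega> \<sigma> ! Suc m ! x = \<omega> ! Suc m ! (\<sigma> ! Suc m ! x)" if "m < n" "x < length (T ! m)" for m x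
    using nth[of "Suc m" x] that by simp
  have \<sigma>_less: "\<sigma> ! Suc m ! x < length (S ! m)" if "m < n" "x < length (T ! m)" for m x
    using tree_homD(5)[OF \<sigma>, of "Suc m" x] that by simp
  have "length (tree_comp \<omega> \<sigma> ! m) = width T m" if "m \<le> n" for m
    using that tree_homD(3,4)[OF \<sigma>] by (simp add: tree_comp_def del: upt_Suc)
  moreover have "tree_comp \<omega> \<sigma> ! m ! x < width R m" if "m \<le> n" "x < width T m" for m x
    using that by (simp add: nth tree_homD(5)[OF \<omega>] tree_homD(5)[OF \<sigma>])
  moreover have "R ! m ! (tree_comp \<omega> \<sigma> ! Suc m ! x) = tree_comp \<omega> \<sigma> ! m ! (T ! m ! x)"
    if "m < n" "x < length (T ! m)" for m x
    using that is_treeD(4)[OF T that]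
    by (simp add: nth Suc_nth tree_homD(6)[OF \<omega>] tree_homD(6)[OF \<sigma>] \<sigma>_less)
  moreover have "tree_comp \<omega> \<sigma> ! Suc m ! x \<le> tree_comp \<omega> \<sigma> ! Suc m ! y"
    if "m < n" "x \<le> y" "y < length (T ! m)" "T ! m ! x = T ! m ! y" for m x y
    using that by (simp add: Suc_nth tree_homD(7)[OF \<omega>] tree_homD(7)[OF \<sigma>] tree_homD(6)[OF \<sigma>] \<sigma>_less)
  moreover have "length (tree_comp \<omega> \<sigma>) = Suc n"
    by (simp add: tree_comp_def tree_homD(3)[OF \<sigma>])
  ultimately show ?thesis
    using tree_homD(1)[OF \<sigma>] tree_homD(2)[OF \<omega>] by (simp add: tree_hom_def)
qed

lemma fibre_map_nth:
  assumes \<sigma>: "\<sigma> \<in> tree_hom n T S" and \<omega>: "\<omega> \<in> tree_hom n S R" and "i < tips R" "m \<le> n"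
    and x: "x < length (fibre_vertices T R (tree_comp \<omega> \<sigma>) i m)"
  defines "y \<equiv> fibre_map T S R \<sigma> \<omega> i ! m ! x"
  shows "y < length (fibre_vertices S R \<omega> i m)"
    "fibre_vertices S R \<omega> i m ! y = \<sigma> ! m ! (fibre_vertices T R (tree_comp \<omega> \<sigma>) i m ! x)"
proof -
  let ?v = "fibre_vertices T R (tree_comp \<omega> \<sigma>) i m ! x"
  have "y = rank (fibre_vertices S R \<omega> i m) (\<sigma> ! m ! ?v)"
    using assms is_treeD(1)[OF tree_homD(1)[OF \<sigma>]] by (simp add: fibre_map_def del: upt_Suc)
  moreover have "\<sigma> ! m ! ?v \<in> set (fibre_vertices S R \<omega> i m)"
    using fibre_vertices_nth[OF x] tree_homD(5)[OF \<sigma>] \<open>m \<le> n\<close>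
    by (auto simp: set_fibre_vertices tree_comp_nth[OF \<sigma>])
  ultimately show "y < length (fibre_vertices S R \<omega> i m)" "fibre_vertices S R \<omega> i m ! y = \<sigma> ! m ! ?v"
    by (simp_all add: nth_rank)
qed

text \<open>Commutation with the structure maps is checked after including the target fibre into S,
  where it becomes that of \<sigma>; the inclusion is injective. Monotonicity on siblings passes
  from \<sigma> through \<open>rank\<close>.\<close>

lemma fibre_map_hom:
  assumes \<sigma>: "\<sigma> \<in> tree_hom n T S" and \<omega>: "\<omega> \<in> tree_hom n S R" and i: "i < tips R"
  shows "fibre_map T S R \<sigma> \<omega> i \<in> tree_hom n (fibre T R (tree_comp \<omega> \<sigma>) i) (fibre S R \<omega> i)"
proof -
  note \<omega>\<sigma> = tree_comp_hom[OF \<sigma> \<omega>]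
  let ?F = "fibre T R (tree_comp \<omega> \<sigma>) i" and ?G = "fibre S R \<omega> i" and ?\<phi> = "fibre_map T S R \<sigma> \<omega> i"
  let ?V = "fibre_vertices T R (tree_comp \<omega> \<sigma>) i" and ?W = "fibre_vertices S R \<omega> i"
  note \<phi> = fibre_map_nth[OF \<sigma> \<omega> i]
  have F: "width ?F m = length (?V m)" and G: "width ?G m = length (?W m)" if "m \<le> n" for m
    using width_fibre[OF \<omega>\<sigma> i that] width_fibre[OF \<omega> i that] by simp_all
  have len: "length (?F ! m) = length (?V (Suc m))" if "m < n" for m
    using F[of "Suc m"] that by simp
  have "length (?\<phi> ! m) = length (?V m)" if "m \<le> n" for m
    using that is_treeD(1)[OF tree_homD(1)[OF \<sigma>]] by (simp add: fibre_map_def del: upt_Suc)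
  moreover have "?G ! m ! (?\<phi> ! Suc m ! x) = ?\<phi> ! m ! (?F ! m ! x)"
    if "m < n" "x < length (?V (Suc m))" for m x
  proof -
    have V: "?V (Suc m) ! x < length (T ! m)"
      using fibre_vertices_nth(1)[OF that(2)] by simp
    note Fx = fibre_nth[OF \<omega>\<sigma> i that] and \<phi>x = \<phi>[of "Suc m", OF _ that(2)]
    note Gx = fibre_nth[OF \<omega> i \<open>m < n\<close> \<phi>x(1)] and \<phi>Fx = \<phi>[OF _ Fx(1)]
    have "?W m ! (?G ! m ! (?\<phi> ! Suc m ! x)) = S ! m ! (\<sigma> ! Suc m ! (?V (Suc m) ! x))"
      using that Gx \<phi>x by simp
    also have "\<dots> = \<sigma> ! m ! (T ! m ! (?V (Suc m) ! x))"
      using tree_homD(6)[OF \<sigma> \<open>m < n\<close> V] .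
    also have "\<dots> = ?W m ! (?\<phi> ! m ! (?F ! m ! x))"
      using that Fx \<phi>Fx by simp
    finally show ?thesis
      using that Gx(1) \<phi>Fx(1) rank_nth[OF sorted_fibre_vertices] by (metis Suc_leI less_imp_le)
  qed
  moreover have "?\<phi> ! Suc m ! x \<le> ?\<phi> ! Suc m ! y"
    if "m < n" "x \<le> y" "y < length (?V (Suc m))" "?F ! m ! x = ?F ! m ! y" for m x y
  proof -
    have "T ! m ! (?V (Suc m) ! x) = T ! m ! (?V (Suc m) ! y)"
      using that fibre_nth(2)[OF \<omega>\<sigma> i \<open>m < n\<close>, of x] fibre_nth(2)[OF \<omega>\<sigma> i \<open>m < n\<close>, of y] by simp
    then have "\<sigma> ! Suc m ! (?V (Suc m) ! x) \<le> \<sigma> ! Suc m ! (?V (Suc m) ! y)"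
      using that fibre_vertices_nth(1)[OF that(3)]
      by (intro tree_homD(7)[OF \<sigma>] fibre_vertices_le) auto
    then have "rank (?W (Suc m)) (\<sigma> ! Suc m ! (?V (Suc m) ! x)) \<le>
        rank (?W (Suc m)) (\<sigma> ! Suc m ! (?V (Suc m) ! y))"
      by (rule rank_mono)
    with that is_treeD(1)[OF tree_homD(1)[OF \<sigma>]] show ?thesis
      by (simp add: fibre_map_def del: upt_Suc)
  qed
  ultimately show ?thesis
    using is_tree_fibre[OF \<omega>\<sigma> i] is_tree_fibre[OF \<omega> i] \<phi>(1) F G is_treeD(1)[OF tree_homD(1)[OF \<sigma>]]
    by (auto simp: tree_hom_def len fibre_map_def[of T S R \<sigma> \<omega> i, THEN arg_cong[of _ _ length]] simp del: width_Suc)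
qed

section \<open>The expression of a tree\<close>

definition big_op :: "nat \<Rightarrow> expr list \<Rightarrow> expr" where
  "big_op i as = foldr (Op i) as Neutral"

lemma big_op_simps [simp]: "big_op i [] = Neutral" "big_op i (a # as) = Op i a (big_op i as)"
  by (simp_all add: big_op_def)

lemma syms_big_op: "syms (big_op i as) = concat (map syms as)"
  by (induction as) auto

lemma subst_big_op: "subst f (big_op i as) = big_op i (map (subst f) as)"
  by (induction as) auto

lemma big_op_exprs: "i \<in> I \<Longrightarrow> (\<And>a. a \<in> set as \<Longrightarrow> a \<in> exprs I) \<Longrightarrow> big_op i as \<in> exprs I"
  by (induction as) (auto intro: exprs.intros)

lemma big_op_filter:
  "(\<And>x. x \<in> set xs \<Longrightarrow> \<not> P x \<Longrightarrow> f x = Neutral) \<Longrightarrow> big_op i (map f (filter P xs)) = big_op i (map f xs)"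
  by (induction xs) auto

text \<open>Since the list increases, the order of the operands is the order of their indices; for a
  tree these are the children of a vertex.\<close>

lemma links_big_op:
  fixes xs :: "nat list"
  shows "sorted_wrt (<) xs \<Longrightarrow> (u, j, v) \<in> links (big_op i (map f xs)) \<longleftrightarrow>
    (\<exists>x\<in>set xs. (u, j, v) \<in> links (f x)) \<or>
    j = i \<and> (\<exists>x\<in>set xs. \<exists>y\<in>set xs. x < y \<and> u \<in> set (syms (f x)) \<and> v \<in> set (syms (f y)))"
proof (induction xs)
  case (Cons x xs)
  have less: "x < y" "\<not> y < x" if "y \<in> set xs" for y
    using Cons.prems that by auto
  have IH: "(u, j, v) \<in> links (big_op i (map f xs)) \<longleftrightarrow>
      (\<exists>x\<in>set xs. (u, j, v) \<in> links (f x)) \<or>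
      j = i \<and> (\<exists>x\<in>set xs. \<exists>y\<in>set xs. x < y \<and> u \<in> set (syms (f x)) \<and> v \<in> set (syms (f y)))"
    using Cons by simp
  show ?case
    using less by (simp add: syms_big_op IH) blast
qed simp

text \<open>The numeric arguments of \<open>vertex_expr\<close> are the height of a vertex, i.e. \<open>n\<close> minus its level, and its
  number in that level.\<close>

primrec vertex_expr :: "(nat \<Rightarrow> nat) \<Rightarrow> tree \<Rightarrow> nat \<Rightarrow> nat \<Rightarrow> expr" where
  "vertex_expr f T 0 x = Sym x"
| "vertex_expr f T (Suc d) x = big_op (f (length T - Suc d))
     (map (vertex_expr f T d) (preimages (T ! (length T - Suc d)) x))"

definition tree_expr :: "(nat \<Rightarrow> nat) \<Rightarrow> tree \<Rightarrow> expr" where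
  "tree_expr f T = vertex_expr f T (length T) 0"

lemma syms_vertex_expr:
  assumes "is_tree n T" "d \<le> n" "x < width T (n - d)"
  shows "distinct (syms (vertex_expr f T d x)) \<and>
    set (syms (vertex_expr f T d x)) = {u. u < tips T \<and> ancestor T (n - d) u = x}"
  using assms(2,3)
proof (induction d arbitrary: x)
  case 0
  with assms(1) show ?case
    using ancestor_length[of T] by (auto simp: is_treeD(1,2)[OF assms(1)])
next
  case (Suc d)
  note T = is_treeD[OF assms(1)]
  define m where "m = n - Suc d"
  have m: "Suc m = n - d" "m < n"
    using Suc.prems by (auto simp: m_def)
  have IH: "distinct (syms (vertex_expr f T d y))"
    "set (syms (vertex_expr f T d y)) = {u. u < tips T \<and> ancestor T (Suc m) u = y}"
    if "y < length (T ! m)" for y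
    using Suc.IH[of y] Suc.prems that unfolding m(1)[symmetric] by auto
  have "ancestor T (Suc m) u < length (T ! m)" if "u < tips T" for u
    using ancestor_less[OF assms(1) that, of "Suc m"] m(2) by simp
  moreover have "ancestor T m u = T ! m ! ancestor T (Suc m) u" for u
    using T(1) m by (simp add: ancestor_Suc)
  moreover have "syms (vertex_expr f T (Suc d) x) =
      concat (map (\<lambda>y. syms (vertex_expr f T d y)) (preimages (T ! m) x))"
    by (simp add: syms_big_op T(1) m_def comp_def)
  moreover have "distinct (concat (map (\<lambda>y. syms (vertex_expr f T d y)) (preimages (T ! m) x)))"
    using IH by (intro distinct_concat_map) (auto simp: set_preimages)
  ultimately show ?case
    unfolding m_def[symmetric] using IH by (auto simp: set_preimages)
qed

text \<open>Two tips above a vertex either lie over different children and are joined by the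
  operation of its own level, or over the same child, where the induction hypothesis supplies the
  level.\<close>

lemma links_vertex_expr:
  assumes "is_tree n T" "d \<le> n" "x < width T (n - d)"
  shows "(u, j, v) \<in> links (vertex_expr f T d x) \<longleftrightarrow> u < tips T \<and> v < tips T \<and>
    ancestor T (n - d) u = x \<and> ancestor T (n - d) v = x \<and>
    (\<exists>m. n - d \<le> m \<and> m < n \<and> j = f m \<and> ancestor T m u = ancestor T m v \<and>
      ancestor T (Suc m) u < ancestor T (Suc m) v)"
  using assms(2,3)
proof (induction d arbitrary: x)
  case 0
  then show ?case by auto
next
  case (Suc d)
  note T = is_treeD[OF assms(1)]
  define l where "l = n - Suc d"
  let ?R = "\<lambda>m. ancestor T m u = ancestor T m v \<and> ancestor T (Suc m) u < ancestor T (Suc m) v"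
  have l: "n - d = Suc l" "l < n"
    using Suc.prems by (auto simp: l_def)
  have IH: "(u, j, v) \<in> links (vertex_expr f T d y) \<longleftrightarrow> u < tips T \<and> v < tips T \<and>
      ancestor T (Suc l) u = y \<and> ancestor T (Suc l) v = y \<and> (\<exists>m. Suc l \<le> m \<and> m < n \<and> j = f m \<and> ?R m)"
    if "y < length (T ! l)" for y
    using Suc.IH[of y] Suc.prems that unfolding l by simp
  have syms: "set (syms (vertex_expr f T d y)) = {u. u < tips T \<and> ancestor T (Suc l) u = y}"
    if "y < length (T ! l)" for y
    using syms_vertex_expr[OF assms(1), of d y f] Suc.prems that unfolding l by simp
  have less: "ancestor T (Suc l) u < length (T ! l)" if "u < tips T" for u
    using ancestor_less[OF assms(1) that, of "Suc l"] l by simp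
  have Suc_l: "ancestor T l u = T ! l ! ancestor T (Suc l) u" for u
    using T(1) l by (simp add: ancestor_Suc)
  have "sorted_wrt (<) (preimages (T ! l) x)"
    unfolding preimages_def by (intro sorted_wrt_filter) simp
  then have "(u, j, v) \<in> links (vertex_expr f T (Suc d) x) \<longleftrightarrow>
      (\<exists>y\<in>set (preimages (T ! l) x). (u, j, v) \<in> links (vertex_expr f T d y)) \<or>
      j = f l \<and> (\<exists>y\<in>set (preimages (T ! l) x). \<exists>z\<in>set (preimages (T ! l) x).
        y < z \<and> u \<in> set (syms (vertex_expr f T d y)) \<and> v \<in> set (syms (vertex_expr f T d z)))"
    by (simp add: links_big_op T(1) l_def)
  also have "\<dots> \<longleftrightarrow> u < tips T \<and> v < tips T \<and> ancestor T l u = x \<and> ancestor T l v = x \<and>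
      (\<exists>m. l \<le> m \<and> m < n \<and> j = f m \<and> ?R m)" (is "?L \<longleftrightarrow> ?M")
  proof
    assume ?L
    then consider y where "y < length (T ! l)" "T ! l ! y = x" "(u, j, v) \<in> links (vertex_expr f T d y)"
      | y z where "y < length (T ! l)" "T ! l ! y = x" "z < length (T ! l)" "T ! l ! z = x" "y < z" "j = f l"
        "u \<in> set (syms (vertex_expr f T d y))" "v \<in> set (syms (vertex_expr f T d z))"
      unfolding set_preimages by blast
    then show ?M
    proof cases
      case 1
      then obtain m where "Suc l \<le> m" "m < n" "j = f m" "?R m" "u < tips T" "v < tips T"
        "ancestor T (Suc l) u = y" "ancestor T (Suc l) v = y"
        using IH by blast
      with 1 show ?thesis by (auto simp: Suc_l intro!: exI[of _ m])
    next
      case 2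
      with l show ?thesis by (auto simp: syms Suc_l intro!: exI[of _ l])
    qed
  next
    assume ?M
    then obtain m where m: "l \<le> m" "m < n" "j = f m" "?R m"
      and uv: "u < tips T" "v < tips T" "ancestor T l u = x" "ancestor T l v = x"
      by blast
    show ?L
    proof (cases "m = l")
      case True
      with m uv show ?thesis
        by (intro disjI2 conjI bexI[of _ "ancestor T (Suc l) u"] bexI[of _ "ancestor T (Suc l) v"])
          (simp_all add: set_preimages syms less flip: Suc_l)
    next
      case False
      with m have "ancestor T (Suc l) u = ancestor T (Suc l) v"
        using ancestor_eq_mono[of T m u v "Suc l"] T(1) by simp
      moreover have "\<exists>m. Suc l \<le> m \<and> m < n \<and> j = f m \<and> ?R m"
        using m False by (intro exI[of _ m]) auto
      ultimately have "(u, j, v) \<in> links (vertex_expr f T d (ancestor T (Suc l) u))"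
        using uv IH[OF less[OF uv(1)]] by simp
      with uv show ?thesis
        by (intro disjI1 bexI[of _ "ancestor T (Suc l) u"]) (simp_all add: set_preimages less flip: Suc_l)
    qed
  qed
  finally show ?case unfolding l_def .
qed

lemma tree_expr_eq: "is_tree n T \<Longrightarrow> tree_expr f T = vertex_expr f T n 0"
  by (simp add: tree_expr_def is_treeD(1))

lemma links_tree_expr:
  assumes "is_tree n T"
  shows "(u, j, v) \<in> links (tree_expr f T) \<longleftrightarrow> u < tips T \<and> v < tips T \<and>
    (\<exists>m<n. j = f m \<and> ancestor T m u = ancestor T m v \<and> ancestor T (Suc m) u < ancestor T (Suc m) v)"
proof -
  have "0 < width T (n - n)"
    by simp
  note links = links_vertex_expr[OF assms order_refl this, of u j v f]
  show ?thesis
    unfolding tree_expr_eq[OF assms] links using ancestor_0[OF assms] by (simp cong: conj_cong)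
qed

lemma syms_tree_expr:
  assumes "is_tree n T"
  shows "distinct (syms (tree_expr f T))" "set (syms (tree_expr f T)) = {..<tips T}"
proof -
  have "0 < width T (n - n)"
    by simp
  note syms = syms_vertex_expr[OF assms order_refl this, of f]
  show "distinct (syms (tree_expr f T))"
    unfolding tree_expr_eq[OF assms] using syms ..
  show "set (syms (tree_expr f T)) = {..<tips T}"
    unfolding tree_expr_eq[OF assms] syms[THEN conjunct2] lessThan_def
    using ancestor_0[OF assms] by (simp cong: conj_cong)
qed

lemma tree_expr_linear:
  assumes "is_tree n T" "f ` {..<n} \<subseteq> I"
  shows "tree_expr f T \<in> linear_exprs I (tips T)"
proof -
  have "vertex_expr f T d x \<in> exprs I" if "d \<le> n" for d x
    using that
  proof (induction d arbitrary: x)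
    case 0
    show ?case by (simp add: exprs.Sym)
  next
    case (Suc d)
    have "f (length T - Suc d) \<in> I"
      unfolding is_treeD(1)[OF assms(1)] using Suc.prems assms(2) by (intro subsetD[OF assms(2)]) simp
    moreover have "vertex_expr f T d y \<in> exprs I" for y
      using Suc by simp
    ultimately show ?case
      by (auto intro!: big_op_exprs)
  qed
  then have "tree_expr f T \<in> exprs I"
    by (simp add: tree_expr_eq[OF assms(1)])
  then show ?thesis
    using syms_tree_expr[OF assms(1)] by (simp add: linear_exprs_iff)
qed

text \<open>The object of the unit tree is the operad unit itself, so an identity can serve as
  \<epsilon>.\<close>

lemma tree_expr_unit_tree: "tree_expr f (unit_tree n) = Sym 0"
proof -
  have "vertex_expr f (unit_tree n) d 0 = Sym 0" if "d \<le> n" for d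
    using that by (induction d) (auto simp: preimages_def unit_tree_def)
  then show ?thesis
    by (simp add: tree_expr_def unit_tree_def)
qed

text \<open>The subtrees outside a fibre contain no tips of it and are turned into neutral elements by the
  restriction.\<close>

lemma vertex_expr_fibre:
  assumes \<sigma>: "\<sigma> \<in> tree_hom n T S" and i: "i < tips S"
    and "d \<le> n" "x < length (fibre_vertices T S \<sigma> i (n - d))"
  shows "relabel ((!) (preimages (\<sigma> ! n) i)) (vertex_expr f (fibre T S \<sigma> i) d x) =
    restr (\<lambda>u. \<sigma> ! n ! u = i) (vertex_expr f T d (fibre_vertices T S \<sigma> i (n - d) ! x))"
  using assms(3,4)
proof (induction d arbitrary: x)
  case 0
  then show ?case
    using nth_mem[of x "preimages (\<sigma> ! n) i"] by (auto simp: fibre_vertices_tips[OF \<sigma>] set_preimages)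
next
  case (Suc d)
  let ?F = "fibre T S \<sigma> i" and ?V = "fibre_vertices T S \<sigma> i" and ?P = "\<lambda>u. \<sigma> ! n ! u = i"
  let ?L = "(!) (preimages (\<sigma> ! n) i)"
  note T = tree_homD(1)[OF \<sigma>]
  define m where "m = n - Suc d"
  have m: "n - d = Suc m" "m < n"
    using Suc.prems by (auto simp: m_def)
  have IH: "relabel ?L (vertex_expr f ?F d y) = restr ?P (vertex_expr f T d (?V (Suc m) ! y))"
    if "y < length (?V (Suc m))" for y
    using Suc.IH[of y] Suc.prems that unfolding m by simp
  have x: "x < length (?V m)"
    using Suc.prems by (simp add: m_def)
  have len: "length (?F ! m) = length (?V (Suc m))"
    using width_fibre[OF \<sigma> i, of "Suc m"] m by simp
  \<comment> \<open>The inclusion of the fibre is injective, so it can be decided in T which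
    vertices are children of x.\<close>
  have "?F ! m ! y = x \<longleftrightarrow> T ! m ! (?V (Suc m) ! y) = ?V m ! x" if "y < length (?V (Suc m))" for y
  proof
    assume "T ! m ! (?V (Suc m) ! y) = ?V m ! x"
    then have "rank (?V m) (?V m ! (?F ! m ! y)) = rank (?V m) (?V m ! x)"
      using fibre_nth(2)[OF \<sigma> i m(2) that] by simp
    then show "?F ! m ! y = x"
      using fibre_nth(1)[OF \<sigma> i m(2) that] x by (simp add: rank_nth)
  qed (use fibre_nth(2)[OF \<sigma> i m(2) that] in simp)
  then have children: "preimages (?F ! m) x =
      filter (\<lambda>y. T ! m ! (?V (Suc m) ! y) = ?V m ! x) [0..<length (?V (Suc m))]"
    unfolding preimages_def len by (intro filter_cong) auto
  have "map (\<lambda>y. relabel ?L (vertex_expr f ?F d y)) (preimages (?F ! m) x) =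
      map (restr ?P \<circ> vertex_expr f T d \<circ> (!) (?V (Suc m))) (preimages (?F ! m) x)"
    using IH by (auto simp: children)
  also have "\<dots> = map (restr ?P \<circ> vertex_expr f T d) (filter (\<lambda>z. T ! m ! z = ?V m ! x)
      (map ((!) (?V (Suc m))) [0..<length (?V (Suc m))]))"
    unfolding children by (simp add: filter_map comp_def)
  \<comment> \<open>The two filters change places: the list becomes that of all children in T,
    filtered by membership in the fibre, as \<open>big_op_filter\<close> requires.\<close>
  also have "\<dots> = map (restr ?P \<circ> vertex_expr f T d) (filter (\<lambda>z. \<sigma> ! Suc m ! z = ancestor S (Suc m) i)
      (preimages (T ! m) (?V m ! x)))"
    unfolding map_nth by (simp add: fibre_vertices_def preimages_def conj_commute)
  finally have "big_op (f m) (map (\<lambda>y. relabel ?L (vertex_expr f ?F d y)) (preimages (?F ! m) x)) =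
      big_op (f m) (map (restr ?P \<circ> vertex_expr f T d) (preimages (T ! m) (?V m ! x)))"
  proof (simp only:, intro big_op_filter)
    fix z assume "z \<in> set (preimages (T ! m) (?V m ! x))" and z: "\<sigma> ! Suc m ! z \<noteq> ancestor S (Suc m) i"
    then have "z < length (T ! m)"
      by (simp add: set_preimages)
    then have "set (syms (vertex_expr f T d z)) = {u. u < tips T \<and> ancestor T (Suc m) u = z}"
      using syms_vertex_expr[OF T, of d z f] Suc.prems unfolding m by simp
    then show "(restr ?P \<circ> vertex_expr f T d) z = Neutral"
      using z tree_hom_ancestor[OF \<sigma>, of _ "Suc m"] m by (auto intro!: subst_Neutral)
  qed
  then show ?case
    using is_treeD(1)[OF T] by (simp add: subst_big_op comp_def m_def)
qed

lemma tree_expr_fibre: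
  assumes \<sigma>: "\<sigma> \<in> tree_hom n T S" and i: "i < tips S"
  shows "relabel ((!) (preimages (\<sigma> ! n) i)) (tree_expr f (fibre T S \<sigma> i)) =
    restr (\<lambda>u. \<sigma> ! n ! u = i) (tree_expr f T)"
  using vertex_expr_fibre[OF assms, of n 0 f] fibre_vertices_root[OF assms]
    is_treeD(1)[OF tree_homD(1)[OF \<sigma>]]
  by (simp add: tree_expr_def)

section \<open>The structure morphisms\<close>

lemma tree_hom_tips:
  assumes "\<sigma> \<in> tree_hom n T S"
  shows "length (\<sigma> ! n) = tips T" "u < tips T \<Longrightarrow> \<sigma> ! n ! u < tips S" "last \<sigma> = \<sigma> ! n"
proof -
  note T = is_treeD(2)[OF tree_homD(1)[OF assms]] and S = is_treeD(2)[OF tree_homD(2)[OF assms]]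
  show "length (\<sigma> ! n) = tips T" "u < tips T \<Longrightarrow> \<sigma> ! n ! u < tips S"
    using tree_homD(4,5)[OF assms, of n] T S by auto
  show "last \<sigma> = \<sigma> ! n"
    using tree_homD(3)[OF assms] by (cases \<sigma> rule: rev_cases) auto
qed

lemma links_restr: "links (restr P a) = {(u, i, v) \<in> links a. P u \<and> P v}"
  by (auto simp: links_subst split: if_splits)

lemma syms_restr: "syms (restr P a) = filter P (syms a)"
  by (induction a) auto

text \<open>\<open>expr_mult\<close> shifts the symbols of argument q past the earlier blocks;
  reading them off the concatenated list undoes the shift.\<close>

lemma relabel_expr_mult:
  assumes "set (syms a) = {..<length xss}" "length ys = length xss"
    and "\<And>q. q < length xss \<Longrightarrow> set (syms (ys ! q)) = {..<length (xss ! q)}"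
  shows "relabel ((!) (concat xss)) (expr_mult (map length xss) a ys) =
    subst (\<lambda>q. relabel ((!) (xss ! q)) (ys ! q)) a"
  using assms by (auto simp: expr_mult_def subst_subst nth_concat_offset intro!: subst_cong)

text \<open>The list \<open>js\<close> is kept general because the fibres occur in two orders: that
  of the tips of S in \<open>mult_source\<close>, and the one sorted by \<omega> in the
  associativity equation.\<close>

lemma relabel_mult_fibres:
  assumes \<sigma>: "\<sigma> \<in> tree_hom n T S" and js: "\<And>j. j \<in> set js \<Longrightarrow> j < tips S"
    and a: "set (syms a) = {..<length js}"
  shows "relabel ((!) (concat (map (preimages (\<sigma> ! n)) js)))
      (expr_mult (map tips (map (fibre T S \<sigma>) js)) a (map (tree_expr f) (map (fibre T S \<sigma>) js))) =
    subst (\<lambda>j. restr (\<lambda>u. \<sigma> ! n ! u = j) (tree_expr f T)) (relabel ((!) js) a)"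
proof -
  have tips: "map tips (map (fibre T S \<sigma>) js) = map length (map (preimages (\<sigma> ! n)) js)"
    using tips_fibre[OF \<sigma> js] by simp
  have "set (syms (tree_expr f (fibre T S \<sigma> j))) = {..<length (preimages (\<sigma> ! n) j)}" if "j \<in> set js" for j
    using syms_tree_expr(2)[OF is_tree_fibre[OF \<sigma> js[OF that]]] tips_fibre[OF \<sigma> js[OF that]] by simp
  then have "relabel ((!) (concat (map (preimages (\<sigma> ! n)) js)))
      (expr_mult (map tips (map (fibre T S \<sigma>) js)) a (map (tree_expr f) (map (fibre T S \<sigma>) js))) =
    subst (\<lambda>q. relabel ((!) (preimages (\<sigma> ! n) (js ! q))) (tree_expr f (fibre T S \<sigma> (js ! q)))) a"
    unfolding tips using a by (subst relabel_expr_mult) (auto intro!: subst_cong)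
  also have "\<dots> = subst (\<lambda>q. restr (\<lambda>u. \<sigma> ! n ! u = js ! q) (tree_expr f T)) a"
    using a js by (intro subst_cong tree_expr_fibre[OF \<sigma>]) auto
  finally show ?thesis
    by (simp add: subst_subst)
qed

definition mult_source :: "(nat \<Rightarrow> nat) \<Rightarrow> tree \<Rightarrow> tree \<Rightarrow> tree_map \<Rightarrow> expr" where
  "mult_source f T S \<sigma> =
    expr_mult (map tips (fibres T S \<sigma>)) (tree_expr f S) (map (tree_expr f) (fibres T S \<sigma>))"

lemma relabel_mult_source:
  assumes "\<sigma> \<in> tree_hom n T S"
  shows "relabel ((!) (sorting (\<sigma> ! n) (tips S))) (mult_source f T S \<sigma>) =
    subst (\<lambda>j. restr (\<lambda>u. \<sigma> ! n ! u = j) (tree_expr f T)) (tree_expr f S)"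
proof -
  have S: "set (syms (tree_expr f S)) = {..<tips S}"
    using syms_tree_expr(2)[OF tree_homD(2)[OF assms]] .
  then have "relabel ((!) [0..<tips S]) (tree_expr f S) = tree_expr f S"
    by (intro relabel_id) auto
  with relabel_mult_fibres[OF assms, of "[0..<tips S]" "tree_expr f S" f] S show ?thesis
    by (simp add: mult_source_def fibres_def sorting_def)
qed

lemma sum_tips_fibres:
  assumes "\<sigma> \<in> tree_hom n T S"
  shows "sum_list (map tips (fibres T S \<sigma>)) = tips T"
proof -
  have "sum_list (map tips (fibres T S \<sigma>)) = length (sorting (\<sigma> ! n) (tips S))"
    by (auto simp: fibres_def sorting_def length_concat tips_fibre[OF assms] intro!: arg_cong[of _ _ sum_list])
  also have "\<dots> = tips T"
    using tree_hom_tips(1,2)[OF assms] by (subst length_sorting) auto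
  finally show ?thesis .
qed

lemma mult_source_linear:
  assumes "\<sigma> \<in> tree_hom n T S" "f ` {..<n} \<subseteq> I"
  shows "mult_source f T S \<sigma> \<in> linear_exprs I (tips T)"
  unfolding mult_source_def sum_tips_fibres[OF assms(1), symmetric]
proof (rule expr_mult_linear)
  show "tree_expr f S \<in> linear_exprs I (length (map tips (fibres T S \<sigma>)))"
    using tree_expr_linear[OF tree_homD(2)[OF assms(1)] assms(2)] by (simp add: fibres_def)
  show "map (tree_expr f) (fibres T S \<sigma>) ! i \<in> linear_exprs I (map tips (fibres T S \<sigma>) ! i)"
    if "i < length (map tips (fibres T S \<sigma>))" for i
    using that tree_expr_linear[OF is_tree_fibre[OF assms(1)] assms(2), of i] by (simp add: fibres_def)
qed

section \<open>The permutation of the tips and the comparison of meeting levels\<close>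

lemma tip_perm_permutes: "\<sigma> \<in> tree_hom n T S \<Longrightarrow> tip_perm \<sigma> permutes {..<tips T}"
  using sort_perm_permutes[of "\<sigma> ! n" "tips S"] tree_hom_tips[of \<sigma> n T S] by (simp add: tip_perm_def)

lemma tip_perm_nth:
  "\<sigma> \<in> tree_hom n T S \<Longrightarrow> q < tips T \<Longrightarrow> tip_perm \<sigma> (sorting (\<sigma> ! n) (tips S) ! q) = q"
  using sort_perm_nth[of "\<sigma> ! n" "tips S"] tree_hom_tips[of \<sigma> n T S] by (simp add: tip_perm_def)

lemma sorting_tip_perm:
  assumes "\<sigma> \<in> tree_hom n T S" "u < tips T"
  shows "sorting (\<sigma> ! n) (tips S) ! tip_perm \<sigma> u = u"
proof -
  have "tip_perm \<sigma> u < tips T"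
    using permutes_in_image[OF tip_perm_permutes[OF assms(1)], of u] assms(2) by simp
  then show ?thesis
    using tip_perm_nth[OF assms(1)] permutes_inj[OF tip_perm_permutes[OF assms(1)]]
    by (auto dest: injD)
qed

lemma length_sorting_tips:
  assumes "\<sigma> \<in> tree_hom n T S"
  shows "length (sorting (\<sigma> ! n) (tips S)) = tips T" "set (sorting (\<sigma> ! n) (tips S)) = {..<tips T}"
  using length_sorting[of "\<sigma> ! n" "tips S"] set_sorting[of "\<sigma> ! n" "tips S"] tree_hom_tips[OF assms] by auto

text \<open>Applied with m the meeting level of u and v in T and r that of their images in
  S.\<close>

lemma meet_level_le:
  assumes \<sigma>: "\<sigma> \<in> tree_hom n T S" and uv: "u < tips T" "v < tips T" and "m < n" "r < n"
    and T: "ancestor T m u = ancestor T m v"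
    and S: "ancestor S (Suc r) (\<sigma> ! n ! u) \<noteq> ancestor S (Suc r) (\<sigma> ! n ! v)"
  shows "m \<le> r" "m = r \<Longrightarrow> ancestor S (Suc r) (\<sigma> ! n ! u) < ancestor S (Suc r) (\<sigma> ! n ! v) \<longleftrightarrow>
    ancestor T (Suc m) u < ancestor T (Suc m) v"
proof -
  note len = is_treeD(1)[OF tree_homD(1)[OF \<sigma>]]
  note anc = tree_hom_ancestor[OF \<sigma> uv(1), symmetric] tree_hom_ancestor[OF \<sigma> uv(2), symmetric]
  show "m \<le> r"
  proof (rule ccontr)
    assume "\<not> m \<le> r"
    then have "ancestor T (Suc r) u = ancestor T (Suc r) v"
      using ancestor_eq_mono[OF T, of "Suc r"] \<open>m < n\<close> len by simp
    with S \<open>r < n\<close> show False by (simp add: anc)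
  qed
  assume "m = r"
  let ?x = "ancestor T (Suc m) u" and ?y = "ancestor T (Suc m) v"
  have less: "?x < length (T ! m)" "?y < length (T ! m)"
    using ancestor_less[OF tree_homD(1)[OF \<sigma>], of _ "Suc m"] uv \<open>m < n\<close> by auto
  have parent: "T ! m ! ?x = T ! m ! ?y"
    using T \<open>m < n\<close> len by (simp add: ancestor_Suc)
  \<comment> \<open>Distinct images turn the weak monotonicity on siblings into an equivalence of
    strict inequalities.\<close>
  have neq: "\<sigma> ! Suc m ! ?x \<noteq> \<sigma> ! Suc m ! ?y"
    using S \<open>m = r\<close> \<open>m < n\<close> by (simp add: anc)
  have "\<sigma> ! Suc m ! ?x < \<sigma> ! Suc m ! ?y \<longleftrightarrow> ?x < ?y"
    using tree_homD(7)[OF \<sigma> \<open>m < n\<close> _ less(2) parent] tree_homD(7)[OF \<sigma> \<open>m < n\<close> _ less(1) parent[symmetric]] neq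
    by (metis le_neq_implies_less less_imp_le not_less)
  then show "ancestor S (Suc r) (\<sigma> ! n ! u) < ancestor S (Suc r) (\<sigma> ! n ! v) \<longleftrightarrow> ?x < ?y"
    using \<open>m = r\<close> \<open>m < n\<close> by (simp add: anc)
qed

text \<open>The two kinds of links of a composite: pairs within one fibre are decided by
  \<open>a\<^sub>T\<close>, pairs in different fibres by \<open>a\<^sub>S\<close>.\<close>

lemma links_relabel_mult_source:
  assumes \<sigma>: "\<sigma> \<in> tree_hom n T S"
  shows "(u, i, v) \<in> links (subst (\<lambda>j. restr (\<lambda>u. \<sigma> ! n ! u = j) (tree_expr f T)) (tree_expr f S)) \<longleftrightarrow>
    (u, i, v) \<in> links (tree_expr f T) \<and> \<sigma> ! n ! u = \<sigma> ! n ! v \<or>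
    u < tips T \<and> v < tips T \<and> (\<sigma> ! n ! u, i, \<sigma> ! n ! v) \<in> links (tree_expr f S)"
proof -
  note T = syms_tree_expr(2)[OF tree_homD(1)[OF \<sigma>], of f] and S = syms_tree_expr(2)[OF tree_homD(2)[OF \<sigma>], of f]
  have "u < tips T" if "(u, i, v) \<in> links (tree_expr f T)"
    using links_syms[OF that] T by simp
  then show ?thesis
    using tree_hom_tips(2)[OF \<sigma>] unfolding links_subst[of _ "tree_expr f S"] links_restr
    by (auto simp: syms_restr T S)
qed

lemma le_links_mult_source:
  assumes \<sigma>: "\<sigma> \<in> tree_hom n T S" and f: "\<And>m r. m < r \<Longrightarrow> r < n \<Longrightarrow> lt (f r) (f m)"
  shows "le_links lt (subst (\<lambda>j. restr (\<lambda>u. \<sigma> ! n ! u = j) (tree_expr f T)) (tree_expr f S)) (tree_expr f T)"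
  unfolding le_links_def links_relabel_mult_source[OF \<sigma>]
proof (intro allI impI)
  note T = tree_homD(1)[OF \<sigma>] and S = tree_homD(2)[OF \<sigma>]
  fix u i v
  assume *: "(u, i, v) \<in> links (tree_expr f T) \<and> \<sigma> ! n ! u = \<sigma> ! n ! v \<or>
    u < tips T \<and> v < tips T \<and> (\<sigma> ! n ! u, i, \<sigma> ! n ! v) \<in> links (tree_expr f S)"
  show "(\<exists>j. (lt i j \<or> i = j) \<and> (u, j, v) \<in> links (tree_expr f T)) \<or>
    (\<exists>j. lt i j \<and> (v, j, u) \<in> links (tree_expr f T))"
  proof (cases "(u, i, v) \<in> links (tree_expr f T)")
    case False
    with * have uv: "u < tips T" "v < tips T" and "(\<sigma> ! n ! u, i, \<sigma> ! n ! v) \<in> links (tree_expr f S)"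
      by auto
    then obtain r where r: "r < n" "i = f r"
      "ancestor S (Suc r) (\<sigma> ! n ! u) < ancestor S (Suc r) (\<sigma> ! n ! v)"
      unfolding links_tree_expr[OF S] by blast
    then have "u \<noteq> v" by auto
    then obtain m where m: "m < n" "ancestor T m u = ancestor T m v" "ancestor T (Suc m) u \<noteq> ancestor T (Suc m) v"
      using meet_level[OF T uv] by blast
    \<comment> \<open>If m = r, the orders agree as well and \<open>a\<^sub>T\<close> would contain
      the same link, which this case excludes. So the level rises strictly, and either order of u
      and v is admissible.\<close>
    have "m \<noteq> r" "m \<le> r"
      using False meet_level_le[OF \<sigma> uv m(1) r(1) m(2)] m r uv unfolding links_tree_expr[OF T] by auto
    then have "lt i (f m)"
      using f r by simp
    moreover have "(u, f m, v) \<in> links (tree_expr f T) \<or> (v, f m, u) \<in> links (tree_expr f T)"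
      using m uv unfolding links_tree_expr[OF T] by (metis linorder_neqE_nat)
    ultimately show ?thesis by blast
  qed blast
qed

text \<open>Now the meeting level in T is given and that of the images is sought. As it is the same
  or larger, \<open>f\<close> has to increase with respect to \<open>lt\<close>.\<close>

lemma le_links_mult_source':
  assumes \<sigma>: "\<sigma> \<in> tree_hom n T S" and f: "\<And>m r. m < r \<Longrightarrow> r < n \<Longrightarrow> lt (f m) (f r)"
  shows "le_links lt (tree_expr f T) (subst (\<lambda>j. restr (\<lambda>u. \<sigma> ! n ! u = j) (tree_expr f T)) (tree_expr f S))"
  unfolding le_links_def links_relabel_mult_source[OF \<sigma>]
proof (intro allI impI)
  note T = tree_homD(1)[OF \<sigma>] and S = tree_homD(2)[OF \<sigma>]
  let ?P = "\<lambda>u j v. (u, j, v) \<in> links (tree_expr f T) \<and> \<sigma> ! n ! u = \<sigma> ! n ! v \<or>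
    u < tips T \<and> v < tips T \<and> (\<sigma> ! n ! u, j, \<sigma> ! n ! v) \<in> links (tree_expr f S)"
  fix u i v
  assume *: "(u, i, v) \<in> links (tree_expr f T)"
  show "(\<exists>j. (lt i j \<or> i = j) \<and> ?P u j v) \<or> (\<exists>j. lt i j \<and> ?P v j u)"
  proof (cases "\<sigma> ! n ! u = \<sigma> ! n ! v")
    case False
    from * obtain m where uv: "u < tips T" "v < tips T" and m: "m < n" "i = f m"
      "ancestor T m u = ancestor T m v" "ancestor T (Suc m) u < ancestor T (Suc m) v"
      unfolding links_tree_expr[OF T] by blast
    note \<sigma>uv = tree_hom_tips(2)[OF \<sigma> uv(1)] tree_hom_tips(2)[OF \<sigma> uv(2)]
    obtain r where r: "r < n" "ancestor S r (\<sigma> ! n ! u) = ancestor S r (\<sigma> ! n ! v)"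
      "ancestor S (Suc r) (\<sigma> ! n ! u) \<noteq> ancestor S (Suc r) (\<sigma> ! n ! v)"
      using meet_level[OF S \<sigma>uv False] by blast
    note le = meet_level_le[OF \<sigma> uv m(1) r(1) m(3) r(3)]
    show ?thesis
    proof (cases "m = r")
      case True
      with le m r \<sigma>uv have "(\<sigma> ! n ! u, i, \<sigma> ! n ! v) \<in> links (tree_expr f S)"
        unfolding links_tree_expr[OF S] by blast
      with uv show ?thesis by blast
    next
      case False
      with le(1) have "lt i (f r)"
        using f m r by simp
      moreover have "(\<sigma> ! n ! u, f r, \<sigma> ! n ! v) \<in> links (tree_expr f S) \<or>
          (\<sigma> ! n ! v, f r, \<sigma> ! n ! u) \<in> links (tree_expr f S)"
        using r \<sigma>uv unfolding links_tree_expr[OF S] by (metis linorder_neqE_nat)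
      ultimately show ?thesis
        using uv by blast
    qed
  qed (use * in blast)
qed

text \<open>\<pi>(\<sigma>) inverts the list used in \<open>relabel_mult_source\<close>. Both ends
  of a structure morphism thus arise by one relabelling from expressions in the tips of T, where
  \<open>le_links_relabel\<close> allows them to be compared.\<close>

lemma relabel_tip_perm:
  assumes \<sigma>: "\<sigma> \<in> tree_hom n T S" and f: "f ` {..<n} \<subseteq> I"
  shows "relabel (tip_perm \<sigma>) (subst (\<lambda>j. restr (\<lambda>u. \<sigma> ! n ! u = j) (tree_expr f T)) (tree_expr f S)) =
      mult_source f T S \<sigma>" (is ?eq)
    and "set (syms (subst (\<lambda>j. restr (\<lambda>u. \<sigma> ! n ! u = j) (tree_expr f T)) (tree_expr f S))) =
      set (syms (tree_expr f T))" (is ?set)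
proof -
  note syms = linear_exprsD(3)[OF mult_source_linear[OF \<sigma> f]]
  show ?eq
    unfolding relabel_mult_source[OF \<sigma>, symmetric] subst_subst subst_simps
  proof (rule relabel_id)
    fix u assume "u \<in> set (syms (mult_source f T S \<sigma>))"
    then show "tip_perm \<sigma> (sorting (\<sigma> ! n) (tips S) ! u) = u"
      unfolding syms by (intro tip_perm_nth[OF \<sigma>]) simp
  qed
  have "(!) (sorting (\<sigma> ! n) (tips S)) ` {..<tips T} = {..<tips T}"
    using length_sorting_tips[OF \<sigma>] by (metis lessThan_atLeast0 nth_image order_refl take_all)
  then show ?set
    unfolding relabel_mult_source[OF \<sigma>, symmetric] syms_relabel set_map syms
      syms_tree_expr(2)[OF tree_homD(1)[OF \<sigma>]] .
qed

lemma mult_source_le: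
  assumes \<sigma>: "\<sigma> \<in> tree_hom n T S" and I: "f ` {..<n} \<subseteq> I"
    and f: "\<And>m r. m < r \<Longrightarrow> r < n \<Longrightarrow> lt (f r) (f m)"
  shows "le_by lt (mult_source f T S \<sigma>) (expr_act (tips T) (tip_perm \<sigma>) (tree_expr f T))"
proof -
  have "le_links lt (mult_source f T S \<sigma>) (expr_act (tips T) (tip_perm \<sigma>) (tree_expr f T))"
    unfolding expr_act_def relabel_tip_perm(1)[OF \<sigma> I, symmetric]
    by (intro le_links_relabel le_links_mult_source[OF \<sigma>] f relabel_tip_perm(2)[OF \<sigma> I])
  then show ?thesis
    using le_by_iff_le_links[OF mult_source_linear[OF \<sigma> I]
        expr_act_linear[OF tip_perm_permutes[OF \<sigma>] tree_expr_linear[OF tree_homD(1)[OF \<sigma>] I]]] by blast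
qed

lemma le_mult_source:
  assumes \<sigma>: "\<sigma> \<in> tree_hom n T S" and I: "f ` {..<n} \<subseteq> I"
    and f: "\<And>m r. m < r \<Longrightarrow> r < n \<Longrightarrow> lt (f m) (f r)"
  shows "le_by lt (expr_act (tips T) (tip_perm \<sigma>) (tree_expr f T)) (mult_source f T S \<sigma>)"
proof -
  have "le_links lt (expr_act (tips T) (tip_perm \<sigma>) (tree_expr f T)) (mult_source f T S \<sigma>)"
    unfolding expr_act_def relabel_tip_perm(1)[OF \<sigma> I, symmetric]
    by (intro le_links_relabel le_links_mult_source'[OF \<sigma>] f relabel_tip_perm(2)[OF \<sigma> I, symmetric])
  then show ?thesis
    using le_by_iff_le_links[OF expr_act_linear[OF tip_perm_permutes[OF \<sigma>] tree_expr_linear[OF tree_homD(1)[OF \<sigma>] I]]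
        mult_source_linear[OF \<sigma> I]] by blast
qed

section \<open>Associativity\<close>

text \<open>Both sides of the associativity condition number the tips of \<open>T\<close> by their images in \<open>R\<close>, then
  by those in \<open>S\<close>, then by themselves. The order is described by concatenating the fibres of \<open>\<sigma>\<close> in
  the order given by \<open>\<omega>\<close> or, equivalently, by concatenating the sorted fibres of the composite.\<close>

lemma map_preimages_fibre_map:
  assumes \<sigma>: "\<sigma> \<in> tree_hom n T S" and \<omega>: "\<omega> \<in> tree_hom n S R" and i: "i < tips R"
    and p: "p < tips (fibre S R \<omega> i)"
  shows "map ((!) (preimages (tree_comp \<omega> \<sigma> ! n) i)) (preimages (fibre_map T S R \<sigma> \<omega> i ! n) p) =
    preimages (\<sigma> ! n) (preimages (\<omega> ! n) i ! p)"
proof -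
  note \<omega>\<sigma> = tree_comp_hom[OF \<sigma> \<omega>] and \<phi> = fibre_map_hom[OF \<sigma> \<omega> i]
  define V W where "V = preimages (tree_comp \<omega> \<sigma> ! n) i" and "W = preimages (\<omega> ! n) i"
  let ?\<phi> = "fibre_map T S R \<sigma> \<omega> i ! n"
  have len: "length ?\<phi> = length V"
    using tree_hom_tips(1)[OF \<phi>] tips_fibre[OF \<omega>\<sigma> i] by (simp add: V_def)
  have p: "p < length W"
    using p tips_fibre[OF \<omega> i] by (simp add: W_def)
  \<comment> \<open>The tips of S over i are listed without repetition, so a value of the induced
    map is determined by the tip of S that it stands for.\<close>
  have "?\<phi> ! x = p \<longleftrightarrow> \<sigma> ! n ! (V ! x) = W ! p" if "x < length V" for x
    using fibre_map_nth[OF \<sigma> \<omega> i order_refl, of x] that p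
    by (simp add: fibre_vertices_tips[OF \<omega>\<sigma>] fibre_vertices_tips[OF \<omega>] nth_eq_iff_index_eq flip: V_def W_def)
      (metis W_def distinct_preimages nth_eq_iff_index_eq)
  then have "preimages ?\<phi> p = filter (\<lambda>x. \<sigma> ! n ! (V ! x) = W ! p) [0..<length V]"
    unfolding preimages_def[of ?\<phi>] len by (intro filter_cong) auto
  then have "map ((!) V) (preimages ?\<phi> p) =
      filter (\<lambda>u. \<sigma> ! n ! u = W ! p) (map ((!) V) [0..<length V])"
    by (simp add: filter_map comp_def)
  also have "\<dots> = filter (\<lambda>u. \<sigma> ! n ! u = W ! p \<and> tree_comp \<omega> \<sigma> ! n ! u = i) [0..<tips T]"
    unfolding map_nth V_def preimages_def tree_hom_tips(1)[OF \<omega>\<sigma>] by (simp add: conj_commute)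
  \<comment> \<open>A tip lying over \<open>W ! p\<close> lies over i automatically, because
    \<omega> sends \<open>W ! p\<close> to i.\<close>
  also have "\<dots> = filter (\<lambda>u. \<sigma> ! n ! u = W ! p) [0..<tips T]"
  proof (rule filter_cong[OF HOL.refl])
    have "W ! p \<in> set W"
      using p by simp
    then have "\<omega> ! n ! (W ! p) = i"
      by (simp add: W_def set_preimages)
    moreover fix u assume "u \<in> set [0..<tips T]"
    then have "tree_comp \<omega> \<sigma> ! n ! u = \<omega> ! n ! (\<sigma> ! n ! u)"
      using tree_comp_nth[OF \<sigma> order_refl] is_treeD(2)[OF tree_homD(1)[OF \<sigma>]] by simp
    ultimately show "(\<sigma> ! n ! u = W ! p \<and> tree_comp \<omega> \<sigma> ! n ! u = i) \<longleftrightarrow> \<sigma> ! n ! u = W ! p"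
      by auto
  qed
  finally show ?thesis
    by (simp add: V_def W_def preimages_def[of "\<sigma> ! n"] tree_hom_tips(1)[OF \<sigma>])
qed

lemma concat_map_concat: "concat (map f (concat xss)) = concat (map (\<lambda>xs. concat (map f xs)) xss)"
  by (induction xss) auto

text \<open>Over each i the fibres of the induced map are, inside T, the fibres of \<sigma> over the
  tips of S above i, in the same order; hence the blocks over i coincide.\<close>

lemma sorting_blocks:
  assumes \<sigma>: "\<sigma> \<in> tree_hom n T S" and \<omega>: "\<omega> \<in> tree_hom n S R"
  shows "concat (map (preimages (\<sigma> ! n)) (sorting (\<omega> ! n) (tips R))) =
    concat (map (\<lambda>i. map ((!) (preimages (tree_comp \<omega> \<sigma> ! n) i))
      (sorting (fibre_map T S R \<sigma> \<omega> i ! n) (tips (fibre S R \<omega> i)))) [0..<tips R])"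
proof -
  have "map ((!) (preimages (tree_comp \<omega> \<sigma> ! n) i))
      (sorting (fibre_map T S R \<sigma> \<omega> i ! n) (tips (fibre S R \<omega> i))) =
    concat (map (preimages (\<sigma> ! n)) (preimages (\<omega> ! n) i))" if i: "i < tips R" for i
  proof -
    have "map ((!) (preimages (tree_comp \<omega> \<sigma> ! n) i))
        (sorting (fibre_map T S R \<sigma> \<omega> i ! n) (tips (fibre S R \<omega> i))) =
      concat (map (\<lambda>p. preimages (\<sigma> ! n) (preimages (\<omega> ! n) i ! p)) [0..<tips (fibre S R \<omega> i)])"
      using map_preimages_fibre_map[OF \<sigma> \<omega> i]
      by (auto simp: sorting_def map_concat intro!: arg_cong[of _ _ concat])
    also have "\<dots> = concat (map (preimages (\<sigma> ! n)) (map ((!) (preimages (\<omega> ! n) i)) [0..<length (preimages (\<omega> ! n) i)]))"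
      by (simp add: tips_fibre[OF \<omega> i] comp_def)
    finally show ?thesis
      unfolding map_nth .
  qed
  then show ?thesis
    by (auto simp: sorting_def[of "\<omega> ! n"] concat_map_concat comp_def intro!: arg_cong[of _ _ concat])
qed

lemma distinct_sorting_blocks: "distinct (concat (map (preimages \<tau>) (sorting \<tau>' k)))"
  by (rule distinct_concat_map) (auto simp: set_preimages distinct_sorting)

lemma inv_tip_perm:
  assumes "\<omega> \<in> tree_hom n S R" "q < tips S"
  shows "inv (tip_perm \<omega>) q = sorting (\<omega> ! n) (tips R) ! q"
  using tip_perm_nth[OF assms] permutes_inv_eq[OF tip_perm_permutes[OF assms(1)]] by blast

lemma permuted_fibres:
  assumes "\<omega> \<in> tree_hom n S R"
  shows "map (\<lambda>q. fibre T S \<sigma> (inv (tip_perm \<omega>) q)) [0..<tips S] =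
    map (fibre T S \<sigma>) (sorting (\<omega> ! n) (tips R))"
  using length_sorting_tips(1)[OF assms] by (intro nth_equalityI) (simp_all add: inv_tip_perm[OF assms])

text \<open>After naming inputs by the list \<open>M\<close> of tips of T, both sides are
  \<open>a\<^sub>R\<close> with i replaced by the part of \<open>a\<^sub>S\<close> over i, in which
  every tip of S is in turn replaced by its part of \<open>a\<^sub>T\<close>. As \<open>M\<close>
  has no repetitions, \<open>relabel_nth_inject\<close> applies.\<close>

lemma assoc_source:
  assumes \<sigma>: "\<sigma> \<in> tree_hom n T S" and \<omega>: "\<omega> \<in> tree_hom n S R" and f: "f ` {..<n} \<subseteq> I"
  defines "Ts \<equiv> map (\<lambda>q. fibre T S \<sigma> (inv (tip_perm \<omega>) q)) [0..<tips S]"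
    and "Ts' \<equiv> fibres T R (tree_comp \<omega> \<sigma>)"
  shows "expr_mult (map tips Ts) (mult_source f S R \<omega>) (map (tree_expr f) Ts) =
    expr_mult (map tips Ts') (tree_expr f R)
      (map (\<lambda>i. mult_source f (Ts' ! i) (fibre S R \<omega> i) (fibre_map T S R \<sigma> \<omega> i)) [0..<tips R])"
    (is "?lhs = ?rhs")
proof -
  note \<omega>\<sigma> = tree_comp_hom[OF \<sigma> \<omega>] and \<phi> = fibre_map_hom[OF \<sigma> \<omega>]
  define js where "js = sorting (\<omega> ! n) (tips R)"
  define M where "M = concat (map (preimages (\<sigma> ! n)) js)"
  let ?part = "\<lambda>j. restr (\<lambda>u. \<sigma> ! n ! u = j) (tree_expr f T)"
  let ?F = "fibre T R (tree_comp \<omega> \<sigma>)" and ?G = "fibre S R \<omega>" and ?\<phi> = "fibre_map T S R \<sigma> \<omega>"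
  let ?V = "preimages (tree_comp \<omega> \<sigma> ! n)" and ?W = "preimages (\<omega> ! n)"
  note js = length_sorting_tips[OF \<omega>, folded js_def]
  have Ts: "Ts = map (fibre T S \<sigma>) js"
    by (simp add: Ts_def js_def permuted_fibres[OF \<omega>])
  have syms_\<omega>: "set (syms (mult_source f S R \<omega>)) = {..<tips S}"
    using linear_exprsD(3)[OF mult_source_linear[OF \<omega> f]] .
  have syms_R: "set (syms (tree_expr f R)) = {..<tips R}"
    using syms_tree_expr(2)[OF tree_homD(2)[OF \<omega>]] .

  \<comment> \<open>The outer composition is unshifted by \<open>M\<close>. What is left is a
    relabelling by \<open>js\<close>, the very list that \<open>relabel_mult_source\<close> uses for
    \<omega>.\<close>
  have "relabel ((!) M) ?lhs = subst ?part (relabel ((!) js) (mult_source f S R \<omega>))"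
    unfolding M_def Ts using js syms_\<omega> by (intro relabel_mult_fibres[OF \<sigma>]) auto
  also have "\<dots> = subst (\<lambda>i. subst ?part (restr (\<lambda>j. \<omega> ! n ! j = i) (tree_expr f S))) (tree_expr f R)"
    unfolding js_def relabel_mult_source[OF \<omega>] by (simp add: subst_subst)
  finally have lhs: "relabel ((!) M) ?lhs =
      subst (\<lambda>i. subst ?part (restr (\<lambda>j. \<omega> ! n ! j = i) (tree_expr f S))) (tree_expr f R)" .

  have part: "relabel ((!) (?V i)) (relabel ((!) (sorting (?\<phi> i ! n) (tips (?G i))))
        (mult_source f (?F i) (?G i) (?\<phi> i))) =
      subst ?part (restr (\<lambda>j. \<omega> ! n ! j = i) (tree_expr f S))" if i: "i < tips R" for i
  proof -
    have V: "?V i = fibre_vertices T R (tree_comp \<omega> \<sigma>) i n" and W: "?W i = fibre_vertices S R \<omega> i n"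
      by (simp_all add: fibre_vertices_tips[OF \<omega>\<sigma>] fibre_vertices_tips[OF \<omega>])
    \<comment> \<open>Seen in T, a fibre of the induced map is a fibre of \<sigma>. Restricting
      \<open>a\<^sub>T\<close> to the tips over i beforehand changes nothing, since that fibre lies
      among them.\<close>
    have inner: "relabel ((!) (?V i)) (restr (\<lambda>w. ?\<phi> i ! n ! w = p) (tree_expr f (?F i))) = ?part (?W i ! p)"
      if p: "p < tips (?G i)" for p
    proof -
      have p: "p < length (?W i)"
        using p tips_fibre[OF \<omega> i] by simp
      have "?W i ! p \<in> set (?W i)"
        using p by simp
      then have Wp: "\<omega> ! n ! (?W i ! p) = i"
        by (simp add: set_preimages)
      have "?\<phi> i ! n ! w = p \<longleftrightarrow> \<sigma> ! n ! (?V i ! w) = ?W i ! p" if "w < length (?V i)" for w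
        using fibre_map_nth[OF \<sigma> \<omega> i order_refl, of w] that p distinct_preimages[of "\<omega> ! n" i]
        unfolding V W by (metis nth_eq_iff_index_eq)
      then have "relabel ((!) (?V i)) (restr (\<lambda>w. ?\<phi> i ! n ! w = p) (tree_expr f (?F i))) =
          restr (\<lambda>u. \<sigma> ! n ! u = ?W i ! p) (relabel ((!) (?V i)) (tree_expr f (?F i)))"
        using syms_tree_expr(2)[OF is_tree_fibre[OF \<omega>\<sigma> i]] tips_fibre[OF \<omega>\<sigma> i]
        by (auto simp: subst_subst intro!: subst_cong)
      also have "\<dots> = restr (\<lambda>u. \<sigma> ! n ! u = ?W i ! p) (restr (\<lambda>u. tree_comp \<omega> \<sigma> ! n ! u = i) (tree_expr f T))"
        by (simp add: tree_expr_fibre[OF \<omega>\<sigma> i])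
      also have "\<dots> = ?part (?W i ! p)"
        using syms_tree_expr(2)[OF tree_homD(1)[OF \<sigma>]] is_treeD(2)[OF tree_homD(1)[OF \<sigma>]] Wp
        by (auto simp: subst_subst tree_comp_nth[OF \<sigma>] intro!: subst_cong)
      finally show ?thesis .
    qed
    have "relabel ((!) (?V i)) (relabel ((!) (sorting (?\<phi> i ! n) (tips (?G i))))
        (mult_source f (?F i) (?G i) (?\<phi> i))) =
      subst (\<lambda>p. relabel ((!) (?V i)) (restr (\<lambda>w. ?\<phi> i ! n ! w = p) (tree_expr f (?F i)))) (tree_expr f (?G i))"
      unfolding relabel_mult_source[OF \<phi>[OF i]] subst_subst[of _ _ "tree_expr f (?G i)"] ..
    also have "\<dots> = subst (\<lambda>p. ?part (?W i ! p)) (tree_expr f (?G i))"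
      using syms_tree_expr(2)[OF is_tree_fibre[OF \<omega> i]] by (intro subst_cong inner) auto
    also have "\<dots> = subst ?part (relabel ((!) (?W i)) (tree_expr f (?G i)))"
      by (simp add: subst_subst)
    finally show ?thesis
      unfolding tree_expr_fibre[OF \<omega> i] .
  qed
  let ?xss = "map (\<lambda>i. map ((!) (?V i)) (sorting (?\<phi> i ! n) (tips (?G i)))) [0..<tips R]"
  have len: "length (sorting (?\<phi> i ! n) (tips (?G i))) = tips (?F i)" if "i < tips R" for i
    using length_sorting_tips(1)[OF \<phi>[OF that]] .
  have tips: "map tips Ts' = map length ?xss"
    by (simp add: Ts'_def fibres_def len)
  have Ts'_nth: "Ts' ! i = ?F i" if "i < tips R" for i
    using that by (simp add: Ts'_def fibres_def)
  have syms_i: "set (syms (mult_source f (?F i) (?G i) (?\<phi> i))) = {..<tips (?F i)}" if "i < tips R" for i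
    using linear_exprsD(3)[OF mult_source_linear[OF \<phi>[OF that] f]] .
  \<comment> \<open>The same list, now cut into blocks indexed by the tips of R, as the outer
    composition on the right-hand side demands.\<close>
  have "M = concat ?xss"
    unfolding M_def js_def by (rule sorting_blocks[OF \<sigma> \<omega>])
  then have "relabel ((!) M) ?rhs =
      subst (\<lambda>i. relabel ((!) (?xss ! i)) (mult_source f (?F i) (?G i) (?\<phi> i))) (tree_expr f R)"
    unfolding tips using syms_R syms_i by (simp only:) (subst relabel_expr_mult, auto simp: len Ts'_nth intro!: subst_cong)
  also have "\<dots> = subst (\<lambda>i. subst ?part (restr (\<lambda>j. \<omega> ! n ! j = i) (tree_expr f S))) (tree_expr f R)"
  proof (rule subst_cong)
    fix i assume "i \<in> set (syms (tree_expr f R))"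
    then have i: "i < tips R"
      using syms_R by simp
    have "relabel ((!) (?xss ! i)) (mult_source f (?F i) (?G i) (?\<phi> i)) =
        relabel ((!) (?V i)) (relabel ((!) (sorting (?\<phi> i ! n) (tips (?G i)))) (mult_source f (?F i) (?G i) (?\<phi> i)))"
      unfolding subst_subst subst_simps
    proof (rule subst_cong)
      fix u assume "u \<in> set (syms (mult_source f (?F i) (?G i) (?\<phi> i)))"
      then have "u < length (sorting (?\<phi> i ! n) (tips (?G i)))"
        using syms_i[OF i] len[OF i] by simp
      with i show "Sym (?xss ! i ! u) = Sym (?V i ! (sorting (?\<phi> i ! n) (tips (?G i)) ! u))"
        by simp
    qed
    then show "relabel ((!) (?xss ! i)) (mult_source f (?F i) (?G i) (?\<phi> i)) =
        subst ?part (restr (\<lambda>j. \<omega> ! n ! j = i) (tree_expr f S))"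
      unfolding part[OF i] .
  qed
  finally have "relabel ((!) M) ?lhs = relabel ((!) M) ?rhs"
    unfolding lhs ..
  moreover have "distinct M"
    unfolding M_def js_def by (rule distinct_sorting_blocks)
  moreover have "set (syms ?lhs) \<subseteq> {..<length M}"
  proof -
    have "map tips Ts = map length (map (preimages (\<sigma> ! n)) js)"
      using js by (simp add: Ts tips_fibre[OF \<sigma>])
    then have "sum_list (map tips Ts) = length M"
      by (simp add: M_def length_concat)
    moreover have "js ! q < tips S" if "q < tips S" for q
      using js that nth_mem[of q js] by simp
    then have "?lhs \<in> linear_exprs I (sum_list (map tips Ts))"
      using js mult_source_linear[OF \<omega> f] tree_expr_linear[OF is_tree_fibre[OF \<sigma>] f]
      by (intro expr_mult_linear) (simp_all add: Ts)
    ultimately show ?thesis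
      using linear_exprsD(3) by fastforce
  qed
  moreover have "set (syms ?rhs) \<subseteq> {..<length M}"
  proof -
    have "sum_list (map tips Ts') = length M"
      unfolding tips \<open>M = concat ?xss\<close> length_concat ..
    moreover have "?rhs \<in> linear_exprs I (sum_list (map tips Ts'))"
      using tree_expr_linear[OF tree_homD(2)[OF \<omega>] f] mult_source_linear[OF \<phi> f]
      by (intro expr_mult_linear) (auto simp: Ts'_def fibres_def)
    ultimately show ?thesis
      using linear_exprsD(3) by fastforce
  qed
  ultimately show ?thesis
    by (rule relabel_nth_inject)
qed

text \<open>Both sides are the position of u in the list \<open>M\<close>, which has no repetitions;
  so it suffices to look up each of them in \<open>M\<close>.\<close>

lemma assoc_target:
  assumes \<sigma>: "\<sigma> \<in> tree_hom n T S" and \<omega>: "\<omega> \<in> tree_hom n S R" and u: "u < tips T"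
  defines "Ts \<equiv> map (\<lambda>q. fibre T S \<sigma> (inv (tip_perm \<omega>) q)) [0..<tips S]"
    and "Ts' \<equiv> fibres T R (tree_comp \<omega> \<sigma>)" and "\<sigma>s \<equiv> map (fibre_map T S R \<sigma> \<omega>) [0..<tips R]"
  shows "block_perm (map tips Ts) (tip_perm \<omega>) (tip_perm \<sigma> u) =
    sum_perm (map tips Ts') (map tip_perm \<sigma>s) (tip_perm (tree_comp \<omega> \<sigma>) u)"
    (is "?l = ?r")
proof -
  note \<omega>\<sigma> = tree_comp_hom[OF \<sigma> \<omega>] and \<phi> = fibre_map_hom[OF \<sigma> \<omega>]
  define js where "js = sorting (\<omega> ! n) (tips R)"
  define M where "M = concat (map (preimages (\<sigma> ! n)) js)"
  let ?F = "fibre T R (tree_comp \<omega> \<sigma>)" and ?G = "fibre S R \<omega>" and ?\<phi> = "fibre_map T S R \<sigma> \<omega>"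
  let ?V = "preimages (\<sigma> ! n)" and ?V' = "preimages (tree_comp \<omega> \<sigma> ! n)"
  note js = length_sorting_tips[OF \<omega>, folded js_def]
  have \<pi>: "tip_perm \<omega> j < tips S" "js ! tip_perm \<omega> j = j" if "j < tips S" for j
    using permutes_in_image[OF tip_perm_permutes[OF \<omega>], of j] sorting_tip_perm[OF \<omega> that] that
    by (auto simp: js_def)
  have tips: "map tips Ts = map length (map ?V js)"
    using js by (auto simp: Ts_def permuted_fibres[OF \<omega>] tips_fibre[OF \<sigma>] simp flip: js_def)
  then have Ts_nth: "map tips Ts ! tip_perm \<omega> j = length (?V j)" if "j < tips S" for j
    using \<pi>[OF that] js that by simp

  \<comment> \<open>Left-hand side: u is the r-th tip over j, \<pi>(\<sigma>) puts it at place r of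
    block j, and \<open>block_perm\<close> moves this block to the place of j in the order given by
    \<omega>.\<close>
  define j where "j = \<sigma> ! n ! u"
  have "u \<in> set (?V j)"
    using u tree_hom_tips(1)[OF \<sigma>] by (simp add: set_preimages j_def)
  then obtain r where r: "r < length (?V j)" "?V j ! r = u"
    by (auto simp: in_set_conv_nth)
  have j: "j < tips S"
    unfolding j_def by (rule tree_hom_tips(2)[OF \<sigma> u])
  have len_Ts: "length (map tips Ts) = tips S"
    by (simp add: Ts_def)
  have sizes: "map (\<lambda>i. map tips Ts ! tip_perm \<omega> i) [0..<length (map tips Ts)] = map (length \<circ> ?V) [0..<tips S]"
    unfolding len_Ts using Ts_nth by simp
  have sum: "sum_list (map (\<lambda>i. map tips Ts ! tip_perm \<omega> i) [0..<length (map tips Ts)]) = sum_list (map tips Ts)"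
    using tip_perm_permutes[OF \<omega>] by (intro sum_list_permute) (simp only: len_Ts)
  have "tip_perm \<sigma> u = offset (map (length \<circ> ?V) [0..<tips S]) j + r"
    using sort_perm_offset[of "\<sigma> ! n" "tips S" j r] r j tree_hom_tips[OF \<sigma>] by (simp add: tip_perm_def)
  then have l: "?l = offset (map tips Ts) (tip_perm \<omega> j) + r"
    using block_perm_offset[OF _ _ _ sum, of j r] r j \<pi>(1)[OF j] Ts_nth[OF j]
    unfolding sizes[unfolded len_Ts] len_Ts by simp
  have l_nth: "M ! ?l = u" and l_less: "?l < length M"
  proof -
    have *: "tip_perm \<omega> j < length (map ?V js)" "r < length (map ?V js ! tip_perm \<omega> j)"
      using \<pi>[OF j] js r j by simp_all
    show "M ! ?l = u"
      using nth_concat_offset[OF *] \<pi>[OF j] js r(2) unfolding l unfolding M_def tips by simp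
    show "?l < length M"
      using offset_less[of "tip_perm \<omega> j" "map tips Ts" r] * unfolding l unfolding M_def length_concat tips by simp
  qed

  let ?xss = "map (\<lambda>i. map ((!) (?V' i)) (sorting (?\<phi> i ! n) (tips (?G i)))) [0..<tips R]"
  \<comment> \<open>Right-hand side: u is the s-th tip over i for the composite;
    \<open>sum_perm\<close> keeps block i in place and sorts it by the induced map.\<close>
  define i where "i = tree_comp \<omega> \<sigma> ! n ! u"
  have i: "i < tips R"
    unfolding i_def by (rule tree_hom_tips(2)[OF \<omega>\<sigma> u])
  have "u \<in> set (?V' i)"
    using u tree_hom_tips(1)[OF \<omega>\<sigma>] by (simp add: set_preimages i_def)
  then obtain s where s: "s < length (?V' i)" "?V' i ! s = u"
    by (auto simp: in_set_conv_nth)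
  have s': "s < tips (?F i)"
    using s tips_fibre[OF \<omega>\<sigma> i] by simp
  have len: "length (sorting (?\<phi> i ! n) (tips (?G i))) = tips (?F i)" if "i < tips R" for i
    using length_sorting_tips(1)[OF \<phi>[OF that]] .
  have tips': "map tips Ts' = map length ?xss"
    by (simp add: Ts'_def fibres_def len)
  have tips'': "map tips Ts' = map (length \<circ> ?V') [0..<tips R]"
    by (simp add: Ts'_def fibres_def tips_fibre[OF \<omega>\<sigma>])
  have "tip_perm (tree_comp \<omega> \<sigma>) u = offset (map tips Ts') i + s"
    using sort_perm_offset[of "tree_comp \<omega> \<sigma> ! n" "tips R" i s] s i tree_hom_tips[OF \<omega>\<sigma>]
    unfolding tips'' by (simp add: tip_perm_def)
  then have r: "?r = offset (map tips Ts') i + tip_perm (?\<phi> i) s"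
    using i s by (simp add: sum_perm_offset tips'' \<sigma>s_def)
  have \<phi>s: "tip_perm (?\<phi> i) s < tips (?F i)"
    using permutes_in_image[OF tip_perm_permutes[OF \<phi>[OF i]], of s] s' by simp
  have M: "M = concat ?xss"
    unfolding M_def js_def by (rule sorting_blocks[OF \<sigma> \<omega>])
  have *: "i < length ?xss" "tip_perm (?\<phi> i) s < length (?xss ! i)"
    using i \<phi>s len[OF i] by simp_all
  have "M ! ?r = ?xss ! i ! tip_perm (?\<phi> i) s"
    using nth_concat_offset[OF *] unfolding r unfolding M tips' .
  also have "\<dots> = u"
    using i \<phi>s len[OF i] sorting_tip_perm[OF \<phi>[OF i] s'] s(2) by simp
  finally have "M ! ?r = u" .
  moreover have "?r < length M"
    using offset_less[of i "map length ?xss" "tip_perm (?\<phi> i) s"] * unfolding r unfolding M length_concat tips' by simp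
  moreover have "distinct M"
    unfolding M_def js_def by (rule distinct_sorting_blocks)
  ultimately show ?thesis
    using l_nth l_less nth_eq_iff_index_eq by metis
qed

section \<open>Internal operads and cooperads of expressions\<close>

lemma expr_act_sorted:
  assumes "sorted (last \<sigma>)"
  shows "expr_act k (tip_perm \<sigma>) x = x"
  unfolding expr_act_def tip_perm_def using sort_perm_mono[OF assms] by (intro relabel_id)

lemma sorted_last_tree_to_unit: "sorted (last (tree_to_unit T))"
  by (simp add: tree_to_unit_def)

lemma sorted_last_tree_id: "sorted (last (tree_id T))"
  by (simp add: tree_id_def)

lemma assoc_target_act:
  assumes \<sigma>: "\<sigma> \<in> tree_hom n T S" and \<omega>: "\<omega> \<in> tree_hom n S R"
  defines "Ts \<equiv> map (\<lambda>q. fibre T S \<sigma> (inv (tip_perm \<omega>) q)) [0..<tips S]"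
    and "Ts' \<equiv> fibres T R (tree_comp \<omega> \<sigma>)" and "\<sigma>s \<equiv> map (fibre_map T S R \<sigma> \<omega>) [0..<tips R]"
  shows "expr_act (tips T) (block_perm (map tips Ts) (tip_perm \<omega>))
      (expr_act (tips T) (tip_perm \<sigma>) (tree_expr f T)) =
    expr_act (tips T) (sum_perm (map tips Ts') (map tip_perm \<sigma>s))
      (expr_act (tips T) (tip_perm (tree_comp \<omega> \<sigma>)) (tree_expr f T))"
  unfolding expr_act_def subst_subst subst_simps Ts_def Ts'_def \<sigma>s_def
  using assoc_target[OF \<sigma> \<omega>] syms_tree_expr(2)[OF tree_homD(1)[OF \<sigma>], of f]
  by (intro subst_cong arg_cong[of _ _ Sym]) (metis lessThan_iff)

text \<open>As a morphism is the pair of its ends, source and target are all the data; the cooperad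
  uses the same pair with the ends exchanged.\<close>

definition structure_map :: "(nat \<Rightarrow> nat) \<Rightarrow> tree \<Rightarrow> tree \<Rightarrow> tree_map \<Rightarrow> expr \<times> expr" where
  "structure_map f T S \<sigma> = (mult_source f T S \<sigma>, expr_act (tips T) (tip_perm \<sigma>) (tree_expr f T))"

text \<open>\<open>Comp\<close> keeps the source of one factor and the target of the other. So
  associativity splits into \<open>assoc_source\<close> and \<open>assoc_target_act\<close>, and
  each unit equation into a unit law of substitution and the triviality of \<pi>(\<sigma>).\<close>

lemma internal_operad_expr_operad:
  assumes lt: "transp lt" and I: "f ` {..<n} \<subseteq> I"
    and f: "\<And>m r. m < r \<Longrightarrow> r < n \<Longrightarrow> lt (f r) (f m)"
  shows "internal_operad (expr_operad I (le_by lt)) n (tree_expr f) (structure_map f) (Sym 0, Sym 0)"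
    (is "internal_operad ?A _ _ _ _")
proof (rule internal_operad.intro[OF categorical_expr_operad[OF lt] internal_operad_axioms.intro])
  fix T S R \<sigma> \<omega>
  show "tree_expr f T \<in> Obj ?A (tips T)" if "is_tree n T"
    using tree_expr_linear[OF that I] by (simp add: expr_operad_def)
  show "structure_map f T S \<sigma> \<in> Hom ?A (tips T)
      (MultObj ?A (map tips (fibres T S \<sigma>)) (tree_expr f S) (map (tree_expr f) (fibres T S \<sigma>)))
      (ActObj ?A (tips T) (tip_perm \<sigma>) (tree_expr f T))" if \<sigma>: "\<sigma> \<in> tree_hom n T S"
    using mult_source_linear[OF \<sigma> I] mult_source_le[where lt = lt, OF \<sigma> I f]
      expr_act_linear[OF tip_perm_permutes[OF \<sigma>] tree_expr_linear[OF tree_homD(1)[OF \<sigma>] I]]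
    by (simp add: expr_operad_def Hom_def structure_map_def flip: mult_source_def)
  show "(Sym 0, Sym 0) \<in> Hom ?A 1 (UnitObj ?A) (tree_expr f (unit_tree n))"
    by (simp add: expr_operad_def Hom_def tree_expr_unit_tree Sym_0_linear le_by_refl)
  show "let \<pi> = tip_perm \<omega>; Ts = map (\<lambda>q. fibre T S \<sigma> (inv \<pi> q)) [0..<tips S];
        Ts' = fibres T R (tree_comp \<omega> \<sigma>); \<sigma>s = map (fibre_map T S R \<sigma> \<omega>) [0..<tips R]
      in Comp ?A (tips T) (ActMor ?A (tips T) (block_perm (map tips Ts) \<pi>) (structure_map f T S \<sigma>))
          (MultMor ?A (map tips Ts) (structure_map f S R \<omega>)
            (map (\<lambda>U. Ident ?A (tips U) (tree_expr f U)) Ts)) =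
        Comp ?A (tips T) (ActMor ?A (tips T) (sum_perm (map tips Ts') (map tip_perm \<sigma>s))
            (structure_map f T R (tree_comp \<omega> \<sigma>)))
          (MultMor ?A (map tips Ts') (Ident ?A (tips R) (tree_expr f R))
            (map (\<lambda>i. structure_map f (Ts' ! i) (fibre S R \<omega> i) (\<sigma>s ! i)) [0..<tips R]))"
    if \<sigma>: "\<sigma> \<in> tree_hom n T S" and \<omega>: "\<omega> \<in> tree_hom n S R"
  proof -
    have mult_sources: "map (\<lambda>i. mult_source f (fibres T R (tree_comp \<omega> \<sigma>) ! i) (fibre S R \<omega> i)
          (map (fibre_map T S R \<sigma> \<omega>) [0..<tips R] ! i)) [0..<tips R] =
        map (\<lambda>i. mult_source f (fibres T R (tree_comp \<omega> \<sigma>) ! i) (fibre S R \<omega> i)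
          (fibre_map T S R \<sigma> \<omega> i)) [0..<tips R]"
      by simp
    show ?thesis
      using assoc_source[OF \<sigma> \<omega> I] assoc_target_act[OF \<sigma> \<omega>, of f]
      by (simp add: Let_def expr_operad_def structure_map_def comp_def mult_sources)
  qed
  show "Comp ?A (tips T) (structure_map f T (unit_tree n) (tree_to_unit T))
      (MultMor ?A [tips T] (Sym 0, Sym 0) [Ident ?A (tips T) (tree_expr f T)]) =
    Ident ?A (tips T) (tree_expr f T)"
    by (simp add: expr_operad_def structure_map_def expr_mult_one_left
        expr_act_sorted[OF sorted_last_tree_to_unit])
  show "Comp ?A (tips T) (structure_map f T T (tree_id T))
      (MultMor ?A (replicate (tips T) 1) (Ident ?A (tips T) (tree_expr f T))
        (replicate (tips T) (Sym 0, Sym 0))) = Ident ?A (tips T) (tree_expr f T)" if "is_tree n T"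
    using expr_mult_one_right[OF tree_expr_linear[OF that I]]
    by (simp add: expr_operad_def structure_map_def expr_act_sorted[OF sorted_last_tree_id])
qed

text \<open>\<open>opposite\<close> reads pairs backwards, so after \<open>prod.swap\<close> the
  equations are those of the operad case; only the inequality behind the structure morphisms is the
  reversed one, \<open>le_mult_source\<close>.\<close>

lemma internal_cooperad_expr_operad:
  assumes lt: "transp lt" and I: "f ` {..<n} \<subseteq> I"
    and f: "\<And>m r. m < r \<Longrightarrow> r < n \<Longrightarrow> lt (f m) (f r)"
  shows "internal_cooperad (expr_operad I (le_by lt)) n (tree_expr f)
    (\<lambda>T S \<sigma>. prod.swap (structure_map f T S \<sigma>)) (Sym 0, Sym 0)"
proof -
  let ?A = "opposite (expr_operad I (le_by lt))" and ?\<nu> = "\<lambda>T S \<sigma>. prod.swap (structure_map f T S \<sigma>)"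
  note cat = categorical_expr_operad[OF lt, of I]
  have "internal_operad ?A n (tree_expr f) ?\<nu> (Sym 0, Sym 0)"
  proof (rule internal_operad.intro[OF categorical_opposite[OF cat] internal_operad_axioms.intro])
    fix T S R \<sigma> \<omega>
    show "tree_expr f T \<in> Obj ?A (tips T)" if "is_tree n T"
      using tree_expr_linear[OF that I] by (simp add: opposite_def expr_operad_def)
    show "?\<nu> T S \<sigma> \<in> Hom ?A (tips T)
        (MultObj ?A (map tips (fibres T S \<sigma>)) (tree_expr f S) (map (tree_expr f) (fibres T S \<sigma>)))
        (ActObj ?A (tips T) (tip_perm \<sigma>) (tree_expr f T))" if \<sigma>: "\<sigma> \<in> tree_hom n T S"
      using mult_source_linear[OF \<sigma> I] le_mult_source[where lt = lt, OF \<sigma> I f]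
        expr_act_linear[OF tip_perm_permutes[OF \<sigma>] tree_expr_linear[OF tree_homD(1)[OF \<sigma>] I]]
      by (simp add: opposite_def expr_operad_def Hom_def structure_map_def flip: mult_source_def)
    show "(Sym 0, Sym 0) \<in> Hom ?A 1 (UnitObj ?A) (tree_expr f (unit_tree n))"
      by (simp add: opposite_def expr_operad_def Hom_def tree_expr_unit_tree Sym_0_linear le_by_refl)
    show "let \<pi> = tip_perm \<omega>; Ts = map (\<lambda>q. fibre T S \<sigma> (inv \<pi> q)) [0..<tips S];
          Ts' = fibres T R (tree_comp \<omega> \<sigma>); \<sigma>s = map (fibre_map T S R \<sigma> \<omega>) [0..<tips R]
        in Comp ?A (tips T) (ActMor ?A (tips T) (block_perm (map tips Ts) \<pi>) (?\<nu> T S \<sigma>))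
            (MultMor ?A (map tips Ts) (?\<nu> S R \<omega>)
              (map (\<lambda>U. Ident ?A (tips U) (tree_expr f U)) Ts)) =
          Comp ?A (tips T) (ActMor ?A (tips T) (sum_perm (map tips Ts') (map tip_perm \<sigma>s))
              (?\<nu> T R (tree_comp \<omega> \<sigma>)))
            (MultMor ?A (map tips Ts') (Ident ?A (tips R) (tree_expr f R))
              (map (\<lambda>i. ?\<nu> (Ts' ! i) (fibre S R \<omega> i) (\<sigma>s ! i)) [0..<tips R]))"
      if \<sigma>: "\<sigma> \<in> tree_hom n T S" and \<omega>: "\<omega> \<in> tree_hom n S R"
    proof -
      have mult_sources: "map (\<lambda>i. mult_source f (fibres T R (tree_comp \<omega> \<sigma>) ! i) (fibre S R \<omega> i)
            (map (fibre_map T S R \<sigma> \<omega>) [0..<tips R] ! i)) [0..<tips R] =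
          map (\<lambda>i. mult_source f (fibres T R (tree_comp \<omega> \<sigma>) ! i) (fibre S R \<omega> i)
            (fibre_map T S R \<sigma> \<omega> i)) [0..<tips R]"
        by simp
      show ?thesis
        using assoc_source[OF \<sigma> \<omega> I] assoc_target_act[OF \<sigma> \<omega>, of f]
        by (simp add: Let_def opposite_def expr_operad_def structure_map_def comp_def mult_sources)
    qed
    show "Comp ?A (tips T) (?\<nu> T (unit_tree n) (tree_to_unit T))
        (MultMor ?A [tips T] (Sym 0, Sym 0) [Ident ?A (tips T) (tree_expr f T)]) =
      Ident ?A (tips T) (tree_expr f T)"
      by (simp add: opposite_def expr_operad_def structure_map_def expr_mult_one_left
          expr_act_sorted[OF sorted_last_tree_to_unit])
    show "Comp ?A (tips T) (?\<nu> T T (tree_id T))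
        (MultMor ?A (replicate (tips T) 1) (Ident ?A (tips T) (tree_expr f T))
          (replicate (tips T) (Sym 0, Sym 0))) = Ident ?A (tips T) (tree_expr f T)" if "is_tree n T"
      using expr_mult_one_right[OF tree_expr_linear[OF that I]]
      by (simp add: opposite_def expr_operad_def structure_map_def expr_act_sorted[OF sorted_last_tree_id])
  qed
  with cat show ?thesis
    by (simp add: internal_cooperad_def)
qed

theorem theorem11p1:
  fixes n :: nat
  assumes "n \<ge> 1"
  shows "contains_internal_operad (m_operad n) n \<and> contains_internal_cooperad (m_operad n) n \<and>
    contains_internal_operad (m_tilde_operad n) n \<and> contains_internal_cooperad (m_tilde_operad n) n"
proof (intro conjI)
  have less: "transp ((<) :: nat \<Rightarrow> nat \<Rightarrow> bool)" and greater: "transp ((>) :: nat \<Rightarrow> nat \<Rightarrow> bool)"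
    by (auto intro: transpI)
  \<comment> \<open>Operations are numbered from 1 to n and an operad needs a decreasing index,
    hence n - m for the levels m < n. The increasing m + 1 serves the cooperad.\<close>
  have "internal_operad (m_operad n) n (tree_expr (\<lambda>m. n - m)) (structure_map (\<lambda>m. n - m)) (Sym 0, Sym 0)"
    unfolding m_operad_def le_m_eq by (rule internal_operad_expr_operad[OF less]) auto
  then show "contains_internal_operad (m_operad n) n"
    unfolding contains_internal_operad_def by blast
  have "internal_cooperad (m_operad n) n (tree_expr Suc)
      (\<lambda>T S \<sigma>. prod.swap (structure_map Suc T S \<sigma>)) (Sym 0, Sym 0)"
    unfolding m_operad_def le_m_eq by (rule internal_cooperad_expr_operad[OF less]) auto
  then show "contains_internal_cooperad (m_operad n) n"
    unfolding contains_internal_cooperad_def by blast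
  \<comment> \<open>Operations are numbered from 0 and \<open>lt\<close> is >, so an operad needs an
    increasing index and the level itself will do. The decreasing n - 1 - m serves the
    cooperad.\<close>
  have "internal_operad (m_tilde_operad n) n (tree_expr (\<lambda>m. m)) (structure_map (\<lambda>m. m)) (Sym 0, Sym 0)"
    unfolding m_tilde_operad_def le_m_tilde_eq by (rule internal_operad_expr_operad[OF greater]) auto
  then show "contains_internal_operad (m_tilde_operad n) n"
    unfolding contains_internal_operad_def by blast
  have "internal_cooperad (m_tilde_operad n) n (tree_expr (\<lambda>m. n - Suc m))
      (\<lambda>T S \<sigma>. prod.swap (structure_map (\<lambda>m. n - Suc m) T S \<sigma>)) (Sym 0, Sym 0)"
    unfolding m_tilde_operad_def le_m_tilde_eq by (rule internal_cooperad_expr_operad[OF greater]) auto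
  then show "contains_internal_cooperad (m_tilde_operad n) n"
    unfolding contains_internal_cooperad_def by blast
qed

end
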